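(* The generating function, with respect to the length, of fully commutative involutions of type $\widetilde{A}_{n-1}$, that is $\sum_{w}t^{\ell(w)}$ over all fully commutative involutions $w\in\widetilde A_{n-1}$, is equal to $$\frac{t^{n}\,\check{O}_n(t)}{1-t^{n}}+[x^n]\,\frac{M(x)\left(1+tx^2\,\frac{\partial (xM)}{\partial x}(tx)\right)}{1-xM(x)}.$$ Moreover, if $n$ is odd, this expression is a polynomial in $t$, while if $n$ is even, the corresponding growth sequence $(a_l)_{l\ge0}$, where $a_l$ is the number of fully commutative involutions of length $l$ in $\widetilde A_{n-1}$, is ultimately periodic with period dividing $n$. Finally, in the latter case ($n$ even), periodicity starts at length $1+n^2/4$.
   Context: $n\ge3$. $\widetilde A_{n-1}$ is the Coxeter group with generators $s_0,\dots,s_{n-1}$ whose Coxeter graph is the cycle $s_0-s_1-\cdots-s_{n-1}-s_0$ with all edges labelled $3$. With $\ell$ the Coxeter length, an element $w$ is fully commutative (FC) if any reduced expression of $w$ can be obtained from any other one using only commutation relations $st=ts$ (pairs of commuting generators). An involution is an element with $w^2=1$ (identity included). Walks: consider sequences of points $P_i=(i,h_i)$, $0\le i\le n$, with $h_i\in\mathbb{N}=\{0,1,2,\dots\}$ and all steps $P_{i+1}-P_i\in\{(1,1),(1,-1)\}$. $O_n(t)$ is the generating function of those walks of length $n$ that start and end at the same height ($h_0=h_n$, any common height), and $\check O_n(t)$ is the generating function $\sum t^{h_1+h_2+\cdots+h_n}$ over those among them that moreover hit the $x$-axis, i.e. $h_i=0$ for some $i$. (Since $h_0=h_n$, the exponent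 $h_1+\cdots+h_n$ is the area below the walk.) $M(x)=\sum_{m\ge0}x^m\sum t^{h_0+\cdots+h_m}$, the inner sum being over sequences of points $P_i=(i,h_i)$, $0\le i\le m$, with $h_i\in\mathbb{N}$, all steps $P_{i+1}-P_i\in\{(1,1),(1,-1)\}$, and $h_0=h_m=0$ (Dyck paths of length $m$). $\frac{\partial (xM)}{\partial x}(tx)$ means: differentiate $xM(x)$ with respect to $x$ (with $t$ fixed) and then substitute $tx$ for $x$. $[x^n]F(x)$ is the coefficient of $x^n$ in the power series $F(x)$.
   Formalization: "Periodicity starts at length 1+n²/4" is stated as: the sequence is periodic from length 1+n²/4 on; it is not claimed that this is the first such length, which is false (for n=4 the sequence is 1,4,2,0,4,0,2,0,4,…, periodic already from length 2). *)

theory Defs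
  imports "HOL-Algebra.Group" "HOL-Computational_Algebra.Computational_Algebra"
begin

section \<open>Coxeter groups\<close>

text \<open>
  A Coxeter system is given by a set \<open>S\<close> of generators and a matrix \<open>m\<close>. Words are lists over
  \<open>S\<close>; the congruence below is generated by \<open>(st)^(m s t) = 1\<close>, where \<open>m s s = 1\<close> makes the
  generators involutions (so that the monoid presentation already yields a group), and
  \<open>m s t = 0\<close> would encode the absence of a relation.
\<close>

inductive coxeter_cong :: "'a set \<Rightarrow> ('a \<Rightarrow> 'a \<Rightarrow> nat) \<Rightarrow> 'a list \<Rightarrow> 'a list \<Rightarrow> bool"
  for S :: "'a set" and m :: "'a \<Rightarrow> 'a \<Rightarrow> nat" where
  relator: "\<lbrakk>u \<in> lists S; v \<in> lists S; s \<in> S; t \<in> S\<rbrakk>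
    \<Longrightarrow> coxeter_cong S m (u @ concat (replicate (m s t) [s, t]) @ v) (u @ v)"
| refl: "u \<in> lists S \<Longrightarrow> coxeter_cong S m u u"
| sym: "coxeter_cong S m u v \<Longrightarrow> coxeter_cong S m v u"
| trans: "coxeter_cong S m u v \<Longrightarrow> coxeter_cong S m v w \<Longrightarrow> coxeter_cong S m u w"

definition coxeter_rel :: "'a set \<Rightarrow> ('a \<Rightarrow> 'a \<Rightarrow> nat) \<Rightarrow> ('a list \<times> 'a list) set" where
  "coxeter_rel S m = {(u, v). coxeter_cong S m u v}"

text \<open>A group element is the set of all words that represent it.\<close>

definition coxeter_group :: "'a set \<Rightarrow> ('a \<Rightarrow> 'a \<Rightarrow> nat) \<Rightarrow> 'a list set monoid" where
  "coxeter_group S m =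
     \<lparr>carrier = lists S // coxeter_rel S m,
      monoid.mult = (\<lambda>A B. \<Union>u\<in>A. \<Union>v\<in>B. coxeter_rel S m `` {u @ v}),
      monoid.one = coxeter_rel S m `` {[]}\<rparr>"

definition coxeter_length :: "'a list set \<Rightarrow> nat" where
  "coxeter_length w = (LEAST k. \<exists>u\<in>w. length u = k)"

definition reduced_words :: "'a list set \<Rightarrow> 'a list set" where
  "reduced_words w = {u \<in> w. length u = coxeter_length w}"

definition commutation_step :: "('a \<Rightarrow> 'a \<Rightarrow> nat) \<Rightarrow> 'a list \<Rightarrow> 'a list \<Rightarrow> bool" where
  "commutation_step m u v \<longleftrightarrow>
     (\<exists>x y s t. m s t = 2 \<and> u = x @ [s, t] @ y \<and> v = x @ [t, s] @ y)"

definition fully_commutative :: "('a \<Rightarrow> 'a \<Rightarrow> nat) \<Rightarrow> 'a list set \<Rightarrow> bool" where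
  "fully_commutative m w \<longleftrightarrow>
     (\<forall>u\<in>reduced_words w. \<forall>v\<in>reduced_words w. (commutation_step m)\<^sup>*\<^sup>* u v)"

definition fc_involutions :: "'a set \<Rightarrow> ('a \<Rightarrow> 'a \<Rightarrow> nat) \<Rightarrow> 'a list set set" where
  "fc_involutions S m =
     {w \<in> carrier (coxeter_group S m).
        fully_commutative m w \<and>
        w \<otimes>\<^bsub>coxeter_group S m\<^esub> w = \<one>\<^bsub>coxeter_group S m\<^esub>}"

lemma coxeter_cong_lists:
  "coxeter_cong S m u v \<Longrightarrow> u \<in> lists S \<and> v \<in> lists S"
  by (induction rule: coxeter_cong.induct) (auto simp: set_replicate_conv_if split: if_splits)

lemma coxeter_cong_append_left:
  "coxeter_cong S m u v \<Longrightarrow> x \<in> lists S \<Longrightarrow> coxeter_cong S m (x @ u) (x @ v)"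
proof (induction rule: coxeter_cong.induct)
  case (relator u v s t)
  then have "x @ u \<in> lists S" by simp
  from coxeter_cong.relator[OF this relator(2-4), of m] show ?case by simp
next
  case (refl u)
  with \<open>x \<in> lists S\<close> show ?case by (intro coxeter_cong.refl) simp
next
  case (sym u v)
  then show ?case by (blast intro: coxeter_cong.sym)
next
  case (trans u v w)
  from coxeter_cong.trans[OF trans.IH(1)[OF trans.prems] trans.IH(2)[OF trans.prems]]
  show ?case .
qed

lemma coxeter_cong_append_right:
  "coxeter_cong S m u v \<Longrightarrow> x \<in> lists S \<Longrightarrow> coxeter_cong S m (u @ x) (v @ x)"
proof (induction rule: coxeter_cong.induct)
  case (relator u v s t)
  then have "v @ x \<in> lists S" by simp
  from coxeter_cong.relator[OF relator(1) this relator(3,4), of m] show ?case by simp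
next
  case (refl u)
  with \<open>x \<in> lists S\<close> show ?case by (intro coxeter_cong.refl) simp
next
  case (sym u v)
  then show ?case by (blast intro: coxeter_cong.sym)
next
  case (trans u v w)
  from coxeter_cong.trans[OF trans.IH(1)[OF trans.prems] trans.IH(2)[OF trans.prems]]
  show ?case .
qed

lemma equiv_coxeter_rel: "equiv (lists S) (coxeter_rel S m)"
  unfolding equiv_def
proof (intro conjI)
  show "coxeter_rel S m \<subseteq> lists S \<times> lists S"
    unfolding coxeter_rel_def by (blast dest: coxeter_cong_lists)
  show "refl_on (lists S) (coxeter_rel S m)"
    by (auto simp: refl_on_def coxeter_rel_def intro: coxeter_cong.refl)
  show "Relation.sym (coxeter_rel S m)"
    by (auto simp: sym_def coxeter_rel_def intro: coxeter_cong.sym)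
  show "Relation.trans (coxeter_rel S m)"
    unfolding trans_def coxeter_rel_def by (blast dest: coxeter_cong.trans)
qed

lemma coxeter_mult_class:
  assumes "u \<in> lists S" "v \<in> lists S"
  shows "(coxeter_rel S m `` {u}) \<otimes>\<^bsub>coxeter_group S m\<^esub> (coxeter_rel S m `` {v})
           = coxeter_rel S m `` {u @ v}"
proof -
  have "coxeter_rel S m `` {u' @ v'} = coxeter_rel S m `` {u @ v}"
    if "(u, u') \<in> coxeter_rel S m" "(v, v') \<in> coxeter_rel S m" for u' v'
  proof (rule equiv_class_eq[OF equiv_coxeter_rel])
    from that have *: "coxeter_cong S m u u'" "coxeter_cong S m v v'"
      by (auto simp: coxeter_rel_def)
    then have "coxeter_cong S m (u @ v) (u' @ v')"
      using coxeter_cong.trans[OF coxeter_cong_append_right[OF *(1) assms(2)]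
          coxeter_cong_append_left[OF *(2)]] coxeter_cong_lists[OF *(1)]
      by blast
    then show "(u' @ v', u @ v) \<in> coxeter_rel S m"
      by (auto simp: coxeter_rel_def intro: coxeter_cong.sym)
  qed
  moreover have "(u, u) \<in> coxeter_rel S m" "(v, v) \<in> coxeter_rel S m"
    using assms by (auto simp: coxeter_rel_def intro: coxeter_cong.refl)
  ultimately have "(\<Union>u'\<in>coxeter_rel S m `` {u}. \<Union>v'\<in>coxeter_rel S m `` {v}. coxeter_rel S m `` {u' @ v'})
      = coxeter_rel S m `` {u @ v}"
    by blast
  then show ?thesis by (simp add: coxeter_group_def)
qed

lemma group_coxeter_group:
  assumes "\<And>s. s \<in> S \<Longrightarrow> m s s = 1"
  shows "group (coxeter_group S m)"
proof (rule groupI)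
  let ?G = "coxeter_group S m" and ?c = "\<lambda>u. coxeter_rel S m `` {u}"
  have carr: "x \<in> carrier ?G \<longleftrightarrow> (\<exists>u\<in>lists S. x = ?c u)" for x
    by (auto simp: coxeter_group_def quotient_def)
  have one: "\<one>\<^bsub>?G\<^esub> = ?c []" by (simp add: coxeter_group_def)
  show "x \<otimes>\<^bsub>?G\<^esub> y \<in> carrier ?G" if "x \<in> carrier ?G" "y \<in> carrier ?G" for x y
  proof -
    from that obtain u v where "u \<in> lists S" "v \<in> lists S" "x = ?c u" "y = ?c v"
      unfolding carr by auto
    then have "u @ v \<in> lists S" "x \<otimes>\<^bsub>?G\<^esub> y = ?c (u @ v)" by (simp_all add: coxeter_mult_class)
    then show ?thesis unfolding carr by blast
  qed
  show "\<one>\<^bsub>?G\<^esub> \<in> carrier ?G"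
    unfolding carr one by (rule bexI[of _ "[]"]) auto
  show "x \<otimes>\<^bsub>?G\<^esub> y \<otimes>\<^bsub>?G\<^esub> z = x \<otimes>\<^bsub>?G\<^esub> (y \<otimes>\<^bsub>?G\<^esub> z)"
    if "x \<in> carrier ?G" "y \<in> carrier ?G" "z \<in> carrier ?G" for x y z
  proof -
    from that obtain u v w where "u \<in> lists S" "v \<in> lists S" "w \<in> lists S"
      "x = ?c u" "y = ?c v" "z = ?c w"
      unfolding carr by auto
    moreover from this have "u @ v \<in> lists S" "v @ w \<in> lists S" by simp_all
    ultimately show ?thesis by (simp only: coxeter_mult_class append_assoc)
  qed
  show "\<one>\<^bsub>?G\<^esub> \<otimes>\<^bsub>?G\<^esub> x = x" if "x \<in> carrier ?G" for x
  proof -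
    from that obtain u where "u \<in> lists S" "x = ?c u" unfolding carr by auto
    then show ?thesis by (simp add: one coxeter_mult_class)
  qed
  show "\<exists>y\<in>carrier ?G. y \<otimes>\<^bsub>?G\<^esub> x = \<one>\<^bsub>?G\<^esub>" if "x \<in> carrier ?G" for x
  proof -
    from that obtain u where u: "u \<in> lists S" "x = ?c u" unfolding carr by auto
    have "coxeter_cong S m (rev u @ u) []" using u(1)
    proof (induction u)
      case Nil
      then show ?case by (auto intro: coxeter_cong.refl)
    next
      case (Cons s u)
      then have "coxeter_cong S m (rev u @ concat (replicate (m s s) [s, s]) @ u) (rev u @ u)"
        by (intro coxeter_cong.relator) (auto simp: in_lists_conv_set)
      moreover have "m s s = 1" using assms Cons by auto
      ultimately have "coxeter_cong S m (rev (s # u) @ s # u) (rev u @ u)" by simp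
      moreover have "coxeter_cong S m (rev u @ u) []" using Cons by simp
      ultimately show ?case by (rule coxeter_cong.trans)
    qed
    then have "?c (rev u @ u) = ?c []"
      by (intro equiv_class_eq[OF equiv_coxeter_rel]) (simp add: coxeter_rel_def)
    moreover have ru: "rev u \<in> lists S" using u(1) by (simp add: in_lists_conv_set)
    ultimately have "?c (rev u) \<otimes>\<^bsub>?G\<^esub> x = \<one>\<^bsub>?G\<^esub>"
      using u by (simp add: one coxeter_mult_class)
    then show ?thesis using ru carr by blast
  qed
qed

section \<open>The affine type\<close>

text \<open>Generators \<open>0, \<dots>, n - 1\<close>, Coxeter graph the cycle; meant for \<open>n \<ge> 3\<close>.\<close>

definition affine_A_matrix :: "nat \<Rightarrow> nat \<Rightarrow> nat \<Rightarrow> nat" where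
  "affine_A_matrix n i j =
     (if i = j then 1 else if j = (i + 1) mod n \<or> i = (j + 1) mod n then 3 else 2)"

definition affine_A_fc_involutions :: "nat \<Rightarrow> nat list set set" where
  "affine_A_fc_involutions n = fc_involutions {..<n} (affine_A_matrix n)"

definition fc_involution_count :: "nat \<Rightarrow> nat \<Rightarrow> nat" where
  "fc_involution_count n l = card {w \<in> affine_A_fc_involutions n. coxeter_length w = l}"

section \<open>Generating functions\<close>

text \<open>
  The series \<open>\<Sum>x\<in>A. t^(wt x)\<close>, with \<open>t\<close> being \<^term>\<open>fps_X :: rat fps\<close>. It is meaningful only
  if \<open>wt\<close> has finite fibres on \<open>A\<close>; this is proved below for every use.
\<close>

definition gen_fun :: "'a set \<Rightarrow> ('a \<Rightarrow> nat) \<Rightarrow> rat fps" where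
  "gen_fun A wt = Abs_fps (\<lambda>k. of_nat (card {x \<in> A. wt x = k}))"

text \<open>The list \<open>[h\<^sub>0, \<dots>, h\<^sub>m]\<close> of heights encodes a walk of length \<open>m\<close>.\<close>

definition walks :: "nat \<Rightarrow> nat list set" where
  "walks m = {h. length h = m + 1 \<and>
     (\<forall>i<m. h ! (i + 1) = h ! i + 1 \<or> h ! i = h ! (i + 1) + 1)}"

definition O_walks :: "nat \<Rightarrow> nat list set" where
  "O_walks n = {h \<in> walks n. h ! 0 = h ! n}"

definition O_check :: "nat \<Rightarrow> rat fps" where
  "O_check n = gen_fun {h \<in> O_walks n. \<exists>i\<le>n. h ! i = 0} (\<lambda>h. \<Sum>i=1..n. h ! i)"

definition dyck_paths :: "nat \<Rightarrow> nat list set" where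
  "dyck_paths m = {h \<in> walks m. h ! 0 = 0 \<and> h ! m = 0}"

text \<open>
  In \<^typ>\<open>rat fps fps\<close> the outer variable is \<open>x\<close> and the inner one is \<open>t\<close>: thus \<open>x\<close> is
  \<^term>\<open>fps_X :: rat fps fps\<close> and \<open>t\<close> is \<^term>\<open>fps_const fps_X :: rat fps fps\<close>.
\<close>

definition dyck_M :: "rat fps fps" where
  "dyck_M = Abs_fps (\<lambda>m. gen_fun (dyck_paths m) (\<lambda>h. \<Sum>i=0..m. h ! i))"

definition fc_involution_expr :: "nat \<Rightarrow> rat fps" where
  "fc_involution_expr n =
     (let x = fps_X :: rat fps fps; t = fps_const fps_X :: rat fps fps in
      fps_X ^ n * O_check n / (1 - fps_X ^ n) +
      fps_nth (dyck_M * (1 + t * x\<^sup>2 * fps_compose (fps_deriv (x * dyck_M)) (t * x))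
                 / (1 - x * dyck_M)) n)"

text \<open>
  The coefficients \<^typ>\<open>rat fps\<close> do not form a field, but the division by \<open>1 - x M\<close> is a genuine
  one because this series has constant term 1.
\<close>

lemma divide_one_minus_x_dyck_M:
  "(f / (1 - fps_X * dyck_M)) * (1 - fps_X * dyck_M) = f"
proof -
  define g where "g = 1 - fps_X * dyck_M"
  have g0: "fps_nth g 0 = 1" by (simp add: g_def)
  have "inverse g = fps_right_inverse g 1"
    by (simp only: fps_inverse_def g0) (simp add: fps_lr_inverse_one_one)
  moreover have "g * fps_right_inverse g 1 = 1"
    by (rule fps_right_inverse) (simp add: g0)
  ultimately have "inverse g * g = 1" by (simp only: mult.commute)
  moreover have "f / g = f * inverse g"
    by (rule fps_divide_unit) (simp add: g0)
  ultimately have "f / g * g = f" by (simp only: mult.assoc mult_1_right)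
  then show ?thesis by (simp only: g_def)
qed

lemma finite_lists_sum:
  fixes k :: nat
  shows "finite {h. length h = m + 1 \<and> (\<Sum>i=0..m. h ! i) = k}"
proof (rule finite_subset)
  show "{h. length h = m + 1 \<and> (\<Sum>i=0..m. h ! i) = k} \<subseteq> {h. set h \<subseteq> {..k} \<and> length h = m + 1}"
  proof (intro subsetI CollectI conjI; elim CollectE conjE)
    fix h x assume h: "length h = m + 1" "(\<Sum>i=0..m. h ! i) = k" and "x \<in> set h"
    then obtain i where "i \<le> m" "x = h ! i"
      by (auto simp: in_set_conv_nth less_Suc_eq_le)
    moreover from this have "h ! i \<le> (\<Sum>i=0..m. h ! i)"
      by (intro member_le_sum) auto
    ultimately show "x \<in> {..k}" using h by simp
  qed
  show "finite {h. set h \<subseteq> {..k} \<and> length h = m + 1}"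
    by (rule finite_lists_length_eq) simp
qed

lemma finite_dyck_fibre:
  "finite {h \<in> dyck_paths m. (\<Sum>i=0..m. h ! i) = k}"
  by (rule finite_subset[OF _ finite_lists_sum[of m k]]) (auto simp: dyck_paths_def walks_def)

lemma finite_O_check_fibre:
  assumes "n > 0"
  shows "finite {h \<in> {h \<in> O_walks n. \<exists>i\<le>n. h ! i = 0}. (\<Sum>i=1..n. h ! i) = k}"
proof (rule finite_subset)
  show "{h \<in> {h \<in> O_walks n. \<exists>i\<le>n. h ! i = 0}. (\<Sum>i=1..n. h ! i) = k}
          \<subseteq> (\<Union>j\<le>2 * k. {h. length h = n + 1 \<and> (\<Sum>i=0..n. h ! i) = j})"
  proof safe
    fix h assume h: "h \<in> O_walks n" and k: "k = (\<Sum>i=1..n. h ! i)"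
    have "h ! n \<le> (\<Sum>i=1..n. h ! i)"
      by (rule member_le_sum) (use assms in auto)
    then have "(\<Sum>i=0..n. h ! i) \<le> 2 * k"
      using h k by (simp add: O_walks_def sum.atLeast_Suc_atMost)
    with h show "h \<in> (\<Union>j\<le>2 * (\<Sum>i=1..n. h ! i). {h. length h = n + 1 \<and> (\<Sum>i=0..n. h ! i) = j})"
      unfolding k by (auto simp: O_walks_def walks_def)
  qed
  show "finite (\<Union>j\<le>2 * k. {h. length h = n + 1 \<and> (\<Sum>i=0..n. h ! i) = j})"
    by (intro finite_UN_I finite_lists_sum) simp
qed

lemma finite_fc_involutions_fibre:
  "finite {w \<in> affine_A_fc_involutions n. coxeter_length w = l}"
proof (rule finite_subset)
  let ?r = "coxeter_rel {..<n} (affine_A_matrix n)"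
  let ?L = "{u. set u \<subseteq> {..<n} \<and> length u = l}"
  show "finite ((\<lambda>u. ?r `` {u}) ` ?L)"
    by (intro finite_imageI finite_lists_length_eq) simp
  show "{w \<in> affine_A_fc_involutions n. coxeter_length w = l} \<subseteq> (\<lambda>u. ?r `` {u}) ` ?L"
  proof safe
    fix w assume "w \<in> affine_A_fc_involutions n" and l: "l = coxeter_length w"
    then obtain v where v: "v \<in> lists {..<n}" "w = ?r `` {v}"
      by (auto simp: affine_A_fc_involutions_def fc_involutions_def coxeter_group_def quotient_def)
    then have "v \<in> w"
      by (auto simp: coxeter_rel_def intro: coxeter_cong.refl)
    then have "\<exists>u\<in>w. length u = coxeter_length w"
      unfolding coxeter_length_def by (intro LeastI_ex[of "\<lambda>k. \<exists>u\<in>w. length u = k"]) blast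
    then obtain u where u: "u \<in> w" "length u = coxeter_length w" by blast
    with v have c: "coxeter_cong {..<n} (affine_A_matrix n) v u"
      by (auto simp: coxeter_rel_def)
    then have "w = ?r `` {u}" unfolding v(2)
      by (intro equiv_class_eq[OF equiv_coxeter_rel]) (simp add: coxeter_rel_def)
    moreover have "set u \<subseteq> {..<n}" using coxeter_cong_lists[OF c] by auto
    ultimately show "w \<in> (\<lambda>u. ?r `` {u}) ` {u. set u \<subseteq> {..<n} \<and> length u = coxeter_length w}"
      using u by blast
  qed
qed

end

(* Between two consecutive occurrences of a generator in a reduced word of a fully commutative
   element there are at least two occurrences of neighbours. On a cycle this forces every pair of
   neighbouring generators to alternate. An involution has palindromic projections, so the
   multiplicities h_i and h_(i+1) of neighbours differ by one or both vanish, and h determines the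
   element. Thus fully commutative involutions of length l are cyclic walks of area l, with
   horizontal steps allowed on the axis only.

   That every such h occurs, and with length sum h, comes from an action of the group on integer
   vectors by affine reflections: a generator raises the coordinate sum by at most 2, and passing
   from -h to h forces a word with exactly sum h letters to raise a local minimum at every step.

   Walks avoiding the axis are raised closed walks; walks meeting it are decomposed at their
   horizontal steps and at the excursion around position 0, and have area at most n^2/4. *)

theory Submission
  imports Defs
begin

section \<open>Words up to commutation\<close>

text \<open>The delicate point is that a word with the prescribed projections is reduced and that
  every other reduced word of its element has the same projections. No solution of the word problem
  is used: both claims follow from one potential, the coordinate sum, which bounds the length of any
  congruent word from below and, in case of equality, dictates every letter. A reflection exchanges
  two consecutive slopes, and the bound of 2 per letter needs all slopes to be 1 or -1. A horizontal
  step of \<open>h\<close> has slope 0, so every \<open>h\<close> is given its own action, whose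
  offsets \<open>flat h\<close> turn these steps into slope 1. This explains the parameter
  \<open>f\<close> of the action. No normal form of words is chosen. Words up to commutation are
  compared through their projections to neighbouring generators, and the existence of a word is
  obtained by climbing from \<open>-h\<close> to \<open>h\<close>. The period n comes from raising a
  walk by one, which adds 1 at each of the n positions.\<close>

lemma commutation_steps_append_left:
  "(commutation_step m)\<^sup>*\<^sup>* u v \<Longrightarrow> (commutation_step m)\<^sup>*\<^sup>* (x @ u) (x @ v)"
proof (induction rule: rtranclp_induct)
  case (step v w)
  from step(2) have "commutation_step m (x @ v) (x @ w)"
    unfolding commutation_step_def by (metis append_assoc)
  with step(3) show ?case by simp
qed simp

lemma commutation_steps_append_right:
  "(commutation_step m)\<^sup>*\<^sup>* u v \<Longrightarrow> (commutation_step m)\<^sup>*\<^sup>* (u @ x) (v @ x)"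
proof (induction rule: rtranclp_induct)
  case (step v w)
  from step(2) have "commutation_step m (v @ x) (w @ x)"
    unfolding commutation_step_def by (metis append_assoc)
  with step(3) show ?case by simp
qed simp

lemma commutation_steps_shift_right:
  "\<forall>x\<in>set a. m s x = 2 \<Longrightarrow> (commutation_step m)\<^sup>*\<^sup>* (s # a) (a @ [s])"
proof (induction a)
  case (Cons x a)
  then have "(commutation_step m)\<^sup>*\<^sup>* (x # s # a) (x # a @ [s])"
    using commutation_steps_append_left[of m "s # a" "a @ [s]" "[x]"] by simp
  moreover have "commutation_step m (s # x # a) (x # s # a)"
    unfolding commutation_step_def using Cons.prems
    by (intro exI[of _ "[]"] exI[of _ a] exI[of _ s] exI[of _ x]) simp
  ultimately show ?case by simp
qed simp

lemma commutation_steps_shift_left: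
  "\<forall>x\<in>set a. m x s = 2 \<Longrightarrow> (commutation_step m)\<^sup>*\<^sup>* (a @ [s]) (s # a)"
proof (induction a)
  case (Cons x a)
  then have "(commutation_step m)\<^sup>*\<^sup>* (x # a @ [s]) (x # s # a)"
    using commutation_steps_append_left[of m "a @ [s]" "s # a" "[x]"] by simp
  moreover have "commutation_step m (x # s # a) (s # x # a)"
    unfolding commutation_step_def using Cons.prems
    by (intro exI[of _ "[]"] exI[of _ a] exI[of _ s] exI[of _ x]) simp
  ultimately show ?case by simp
qed simp

lemma commutation_steps_mset: "(commutation_step m)\<^sup>*\<^sup>* u v \<Longrightarrow> mset u = mset v"
  by (induction rule: rtranclp_induct) (auto simp: commutation_step_def)

lemma commutation_steps_filter:
  assumes "(commutation_step m)\<^sup>*\<^sup>* u v"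
    and "\<And>s t. P s \<Longrightarrow> P t \<Longrightarrow> m s t \<noteq> 2"
  shows "filter P u = filter P v"
  using assms(1) by (induction rule: rtranclp_induct) (use assms(2) in \<open>auto simp: commutation_step_def\<close>)

lemma filter_shift_front:
  assumes "filter P (s # u) = filter P (a @ s # b)" and "s \<notin> set a"
    and "P s \<Longrightarrow> filter P a = []"
  shows "filter P u = filter P (a @ b)"
  using assms by (cases "P s") auto

text \<open>A trace is determined by its projections to pairs of dependent letters.\<close>

lemma commutation_steps_if_filter_eq:
  assumes "\<And>s t. m s t = m t s" and "\<And>s. m s s \<noteq> 2"
    and "\<And>s t. s \<in> set u \<union> set v \<Longrightarrow> t \<in> set u \<union> set v \<Longrightarrow> m s t \<noteq> 2 \<Longrightarrow>
           filter (\<lambda>x. x = s \<or> x = t) u = filter (\<lambda>x. x = s \<or> x = t) v"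
  shows "(commutation_step m)\<^sup>*\<^sup>* u v"
  using assms(3)
proof (induction u arbitrary: v)
  case Nil
  have "v = []"
  proof (cases v)
    case (Cons s v')
    with Nil[of s s] assms(2) show ?thesis by simp
  qed simp
  then show ?case by simp
next
  case (Cons s u)
  have "filter (\<lambda>x. x = s \<or> x = s) (s # u) = filter (\<lambda>x. x = s \<or> x = s) v"
    by (rule Cons.prems) (use assms(2) in auto)
  then have "s \<in> set (filter (\<lambda>x. x = s \<or> x = s) v)"
    by (metis (mono_tags, lifting) filter.simps(2) list.set_intros(1))
  then have "s \<in> set v" by simp
  then obtain a b where v: "v = a @ s # b" "s \<notin> set a"
    by (meson split_list_first)
  \<comment> \<open>The projection of \<open>s # u\<close> to \<open>s\<close> and \<open>x\<close>
    begins with \<open>s\<close>. A dependent \<open>x\<close> in \<open>a\<close> would make the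
    same projection of \<open>v\<close> begin with a letter of \<open>a\<close>, which is not
    \<open>s\<close>.\<close>
  have comm: "m s x = 2" if "x \<in> set a" for x
  proof (rule ccontr)
    assume "m s x \<noteq> 2"
    then have "filter (\<lambda>y. y = s \<or> y = x) (s # u) = filter (\<lambda>y. y = s \<or> y = x) v"
      by (intro Cons.prems) (use that v in auto)
    moreover have "filter (\<lambda>y. y = s \<or> y = x) a \<noteq> []"
      using that by (auto simp: filter_empty_conv)
    then obtain z zs where z: "filter (\<lambda>y. y = s \<or> y = x) a = z # zs"
      by (cases "filter (\<lambda>y. y = s \<or> y = x) a") auto
    moreover have "z \<in> set (filter (\<lambda>y. y = s \<or> y = x) a)"
      unfolding z by simp
    then have "z \<in> set a" by simp
    ultimately show False using v by auto
  qed
  have "(commutation_step m)\<^sup>*\<^sup>* u (a @ b)"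
  proof (rule Cons.IH)
    fix p q assume pq: "p \<in> set u \<union> set (a @ b)" "q \<in> set u \<union> set (a @ b)" "m p q \<noteq> 2"
    have "filter (\<lambda>x. x = p \<or> x = q) (s # u) = filter (\<lambda>x. x = p \<or> x = q) (a @ s # b)"
      using pq v by (intro Cons.prems[unfolded v(1)]) auto
    then show "filter (\<lambda>x. x = p \<or> x = q) u = filter (\<lambda>x. x = p \<or> x = q) (a @ b)"
    proof (rule filter_shift_front)
      assume "s = p \<or> s = q"
      then show "filter (\<lambda>x. x = p \<or> x = q) a = []"
        using comm pq(3) v(2) assms(1)[of p q] by (auto simp: filter_empty_conv)
    qed (fact v(2))
  qed
  then have "(commutation_step m)\<^sup>*\<^sup>* (s # u) (s # a @ b)"
    using commutation_steps_append_left[of m u "a @ b" "[s]"] by simp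
  also have "(commutation_step m)\<^sup>*\<^sup>* (s # a @ b) (a @ s # b)"
    using commutation_steps_append_right[OF commutation_steps_shift_right[of a m s], of b] comm
    by simp
  finally show ?case using v by simp
qed

section \<open>Relations in a Coxeter group\<close>

lemma coxeter_cong_context:
  assumes "coxeter_cong S m u v" "x \<in> lists S" "y \<in> lists S"
  shows "coxeter_cong S m (x @ u @ y) (x @ v @ y)"
  using assms by (intro coxeter_cong_append_left coxeter_cong_append_right)

lemma coxeter_cong_relator:
  assumes "u \<in> lists S" "v \<in> lists S" "s \<in> S" "t \<in> S" "w = concat (replicate (m s t) [s, t])"
  shows "coxeter_cong S m (u @ w @ v) (u @ v)"
  using coxeter_cong.relator assms by metis

lemma coxeter_cong_cancel:
  assumes "m s s = 1" "s \<in> S" "u \<in> lists S" "v \<in> lists S"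
  shows "coxeter_cong S m (u @ s # s # v) (u @ v)"
  using coxeter_cong_relator[of u S v s s "[s, s]" m] assms by simp

text \<open>The word \<open>s t s t t s\<close> becomes \<open>t s\<close> when the relator in front
  is removed, and \<open>s t\<close> when the inner squares are cancelled. The braid relation arises
  in the same way.\<close>

lemma coxeter_cong_commute:
  assumes "m s t = 2" "m s s = 1" "m t t = 1" "s \<in> S" "t \<in> S"
  shows "coxeter_cong S m [s, t] [t, s]"
proof (rule coxeter_cong.sym)
  have "coxeter_cong S m ([s, t, s, t] @ [t, s]) [t, s]"
    using coxeter_cong_relator[of "[]" S "[t, s]" s t "[s, t, s, t]" m] assms
    by (simp add: numeral_eq_Suc)
  moreover have "coxeter_cong S m ([s, t, s] @ t # t # [s]) ([s, t, s] @ [s])"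
    using assms by (intro coxeter_cong_cancel) auto
  moreover have "coxeter_cong S m ([s, t] @ s # s # []) ([s, t] @ [])"
    using assms by (intro coxeter_cong_cancel) auto
  ultimately show "coxeter_cong S m [t, s] [s, t]"
    by simp (meson coxeter_cong.sym coxeter_cong.trans)
qed

lemma coxeter_cong_braid:
  assumes "m s t = 3" "m s s = 1" "m t t = 1" "s \<in> S" "t \<in> S"
  shows "coxeter_cong S m [s, t, s] [t, s, t]"
proof (rule coxeter_cong.sym)
  have "coxeter_cong S m ([s, t, s, t, s, t] @ [t, s, t]) [t, s, t]"
    using coxeter_cong_relator[of "[]" S "[t, s, t]" s t "[s, t, s, t, s, t]" m] assms
    by (simp add: numeral_eq_Suc)
  moreover have "coxeter_cong S m ([s, t, s, t, s] @ t # t # [s, t]) ([s, t, s, t, s] @ [s, t])"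
    using assms by (intro coxeter_cong_cancel) auto
  moreover have "coxeter_cong S m ([s, t, s, t] @ s # s # [t]) ([s, t, s, t] @ [t])"
    using assms by (intro coxeter_cong_cancel) auto
  moreover have "coxeter_cong S m ([s, t, s] @ t # t # []) ([s, t, s] @ [])"
    using assms by (intro coxeter_cong_cancel) auto
  ultimately show "coxeter_cong S m [t, s, t] [s, t, s]"
    by simp (meson coxeter_cong.sym coxeter_cong.trans)
qed

lemma coxeter_cong_rev_append:
  assumes "\<And>s. s \<in> S \<Longrightarrow> m s s = 1" "u \<in> lists S"
  shows "coxeter_cong S m (u @ rev u) []"
  using assms(2)
proof (induction u rule: rev_induct)
  case Nil
  then show ?case by (auto intro: coxeter_cong.refl)
next
  case (snoc s u)
  then have "coxeter_cong S m (u @ s # s # rev u) (u @ rev u)"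
    by (intro coxeter_cong_cancel assms) (auto simp: in_lists_conv_set)
  with snoc show ?case by simp (meson coxeter_cong.trans)
qed

lemma coxeter_cong_commutation_steps:
  assumes "(commutation_step m)\<^sup>*\<^sup>* u v" and "\<And>s. s \<in> S \<Longrightarrow> m s s = 1" and "u \<in> lists S"
  shows "coxeter_cong S m u v"
  using assms(1)
proof (induction rule: rtranclp_induct)
  case base
  then show ?case using assms(3) by (rule coxeter_cong.refl)
next
  case (step v w)
  from step(2) obtain x y s t where *: "m s t = 2" "v = x @ [s, t] @ y" "w = x @ [t, s] @ y"
    by (auto simp: commutation_step_def)
  moreover have "v \<in> lists S" using step(3) by (blast dest: coxeter_cong_lists)
  ultimately have "coxeter_cong S m v w"
    unfolding * using *(1) by (intro coxeter_cong_context coxeter_cong_commute) (auto simp: assms(2))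
  with step(3) show ?case by (rule coxeter_cong.trans)
qed

section \<open>Elements as classes of words\<close>

abbreviation coxeter_class :: "'a set \<Rightarrow> ('a \<Rightarrow> 'a \<Rightarrow> nat) \<Rightarrow> 'a list \<Rightarrow> 'a list set" where
  "coxeter_class S m u \<equiv> coxeter_rel S m `` {u}"

lemma mem_coxeter_class: "v \<in> coxeter_class S m u \<longleftrightarrow> coxeter_cong S m u v"
  by (simp add: coxeter_rel_def)

lemma coxeter_class_eq: "coxeter_cong S m u v \<Longrightarrow> coxeter_class S m u = coxeter_class S m v"
  by (intro equiv_class_eq[OF equiv_coxeter_rel]) (simp add: coxeter_rel_def)

lemma coxeter_class_eqD:
  assumes "coxeter_class S m u = coxeter_class S m v" "v \<in> lists S"
  shows "coxeter_cong S m u v"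
proof -
  have "v \<in> coxeter_class S m v"
    using assms(2) by (simp only: mem_coxeter_class coxeter_cong.refl)
  with assms(1) show ?thesis by (simp only: mem_coxeter_class[symmetric])
qed

lemma carrier_coxeter_group:
  "w \<in> carrier (coxeter_group S m) \<longleftrightarrow> (\<exists>u\<in>lists S. w = coxeter_class S m u)"
  by (auto simp: coxeter_group_def quotient_def)

lemma carrier_eq_coxeter_class:
  assumes "w \<in> carrier (coxeter_group S m)" "u \<in> w"
  shows "w = coxeter_class S m u" "u \<in> lists S"
proof -
  from assms obtain v where v: "v \<in> lists S" "w = coxeter_class S m v"
    by (auto simp: carrier_coxeter_group)
  with assms(2) have c: "coxeter_cong S m v u" by (simp add: coxeter_rel_def)
  then show "w = coxeter_class S m u" unfolding v(2) by (rule coxeter_class_eq)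
  from c show "u \<in> lists S" by (blast dest: coxeter_cong_lists)
qed

lemma coxeter_length_le: "u \<in> w \<Longrightarrow> coxeter_length w \<le> length u"
  unfolding coxeter_length_def by (rule Least_le) blast

lemma reduced_words_nonempty:
  assumes "w \<in> carrier (coxeter_group S m)"
  shows "\<exists>u. u \<in> reduced_words w"
proof -
  from assms obtain v where "v \<in> lists S" "w = coxeter_class S m v"
    by (auto simp: carrier_coxeter_group)
  then have "v \<in> w" by (simp add: coxeter_rel_def coxeter_cong.refl)
  then have "\<exists>u\<in>w. length u = coxeter_length w"
    unfolding coxeter_length_def by (intro LeastI_ex[of "\<lambda>k. \<exists>u\<in>w. length u = k"]) blast
  then show ?thesis by (auto simp: reduced_words_def)
qed

lemma reduced_words_cong:
  assumes "w \<in> carrier (coxeter_group S m)" "u \<in> reduced_words w"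
    and "coxeter_cong S m u v" "length v = length u"
  shows "v \<in> reduced_words w"
proof -
  have "w = coxeter_class S m u"
    using assms by (intro carrier_eq_coxeter_class) (auto simp: reduced_words_def)
  with assms show ?thesis by (auto simp: reduced_words_def coxeter_rel_def)
qed

lemma reduced_words_not_shorter:
  assumes "w \<in> carrier (coxeter_group S m)" "u \<in> reduced_words w" "coxeter_cong S m u v"
  shows "length u \<le> length v"
proof -
  have "w = coxeter_class S m u"
    using assms by (intro carrier_eq_coxeter_class) (auto simp: reduced_words_def)
  with assms show ?thesis
    by (auto simp: reduced_words_def coxeter_rel_def intro!: coxeter_length_le)
qed

section \<open>The cyclic Coxeter graph\<close>

locale affine_A =
  fixes n :: nat
  assumes n_ge_3: "n \<ge> 3"
begin

definition nxt :: "nat \<Rightarrow> nat" where "nxt i = (i + 1) mod n"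
definition prv :: "nat \<Rightarrow> nat" where "prv i = (i + (n - 1)) mod n"

abbreviation mat :: "nat \<Rightarrow> nat \<Rightarrow> nat" where "mat \<equiv> affine_A_matrix n"
abbreviation cong :: "nat list \<Rightarrow> nat list \<Rightarrow> bool" where
  "cong \<equiv> coxeter_cong {..<n} mat"
abbreviation comm :: "nat list \<Rightarrow> nat list \<Rightarrow> bool" where
  "comm \<equiv> (commutation_step mat)\<^sup>*\<^sup>*"

lemma nxt_less [simp]: "nxt i < n" and prv_less [simp]: "prv i < n"
  using n_ge_3 by (auto simp: nxt_def prv_def)

lemma nxt_if: "i < n \<Longrightarrow> nxt i = (if i = n - 1 then 0 else i + 1)"
  using n_ge_3 by (auto simp: nxt_def)

lemma prv_if: "i < n \<Longrightarrow> prv i = (if i = 0 then n - 1 else i - 1)"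
  using n_ge_3 by (auto simp: prv_def le_mod_geq)

lemma nxt_prv [simp]: "i < n \<Longrightarrow> nxt (prv i) = i"
  using n_ge_3 by (auto simp: nxt_if prv_if)

lemma prv_nxt [simp]: "i < n \<Longrightarrow> prv (nxt i) = i"
  using n_ge_3 by (auto simp: nxt_if prv_if)

lemma nxt_neq [simp]: "i < n \<Longrightarrow> nxt i \<noteq> i" "i < n \<Longrightarrow> i \<noteq> nxt i"
  and prv_neq [simp]: "i < n \<Longrightarrow> prv i \<noteq> i" "i < n \<Longrightarrow> i \<noteq> prv i"
  and nxt_neq_prv [simp]: "i < n \<Longrightarrow> nxt i \<noteq> prv i" "i < n \<Longrightarrow> prv i \<noteq> nxt i"
  and nxt_nxt_neq [simp]: "i < n \<Longrightarrow> nxt (nxt i) \<noteq> i" "i < n \<Longrightarrow> i \<noteq> nxt (nxt i)"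
  using n_ge_3 by (auto simp: nxt_if prv_if split: if_splits)

lemma nxt_eq_iff: "i < n \<Longrightarrow> j < n \<Longrightarrow> nxt i = j \<longleftrightarrow> i = prv j"
  by auto

lemma mat_refl [simp]: "mat s s = 1"
  by (simp add: affine_A_matrix_def)

lemma mat_sym: "mat s t = mat t s"
  by (auto simp: affine_A_matrix_def)

lemma mat_eq_2_iff: "mat s t = 2 \<longleftrightarrow> s \<noteq> t \<and> t \<noteq> nxt s \<and> s \<noteq> nxt t"
  by (auto simp: affine_A_matrix_def nxt_def)

lemma mat_eq_3_iff: "mat s t = 3 \<longleftrightarrow> s \<noteq> t \<and> (t = nxt s \<or> s = nxt t)"
  by (auto simp: affine_A_matrix_def nxt_def)

lemma mat_cases: "mat s t = 1 \<and> s = t \<or> mat s t = 2 \<or> mat s t = 3"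
  by (auto simp: affine_A_matrix_def)

lemma comm_imp_cong: "comm u v \<Longrightarrow> set u \<subseteq> {..<n} \<Longrightarrow> cong u v"
  by (rule coxeter_cong_commutation_steps) auto

lemma comm_set: "comm u v \<Longrightarrow> set u = set v"
  by (metis commutation_steps_mset set_mset_mset)

lemma commI_edges:
  assumes "set u \<subseteq> {..<n}" "set v \<subseteq> {..<n}"
    and edge: "\<And>i. i < n \<Longrightarrow> filter (\<lambda>x. x = i \<or> x = nxt i) u = filter (\<lambda>x. x = i \<or> x = nxt i) v"
  shows "comm u v"
proof (rule commutation_steps_if_filter_eq)
  fix s t assume "s \<in> set u \<union> set v" "t \<in> set u \<union> set v" and 2: "mat s t \<noteq> 2"
  with assms have st: "s < n" "t < n" by auto
  from 2 consider "s = t" | "t = nxt s" | "s = nxt t" by (auto simp: mat_eq_2_iff)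
  then show "filter (\<lambda>x. x = s \<or> x = t) u = filter (\<lambda>x. x = s \<or> x = t) v"
  proof cases
    case 1
    \<comment> \<open>The projection to a single letter is recovered from an edge projection by
      filtering once more.\<close>
    have "filter (\<lambda>x. x = s \<or> x = t) w = filter (\<lambda>x. x = s) (filter (\<lambda>x. x = s \<or> x = nxt s) w)" for w
      using 1 by (auto intro!: filter_cong)
    with edge[OF st(1)] show ?thesis by metis
  next
    case 2
    with edge[OF st(1)] show ?thesis by simp
  next
    case 3
    with edge[OF st(2)] show ?thesis by (simp add: disj_commute)
  qed
qed (use mat_sym in auto)

section \<open>Height functions\<close>

text \<open>
  The group acts on integer vectors by affine reflections, for every choice of \<open>f\<close>. If all the
  differences \<open>slope f x i\<close> are \<open>1\<close> or \<open>-1\<close>, the vector \<open>x\<close> is a cyclic lattice path, a generator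
  exchanges two consecutive steps of it, and so changes \<open>x i\<close> by \<open>0\<close>, \<open>2\<close> or \<open>-2\<close>.
\<close>

definition slope :: "(nat \<Rightarrow> int) \<Rightarrow> (nat \<Rightarrow> int) \<Rightarrow> nat \<Rightarrow> int" where
  "slope f x i = x (nxt i) - x i + f i"

definition refl_step :: "(nat \<Rightarrow> int) \<Rightarrow> nat \<Rightarrow> (nat \<Rightarrow> int) \<Rightarrow> (nat \<Rightarrow> int)" where
  "refl_step f i x = x(i := x i + slope f x i - slope f x (prv i))"

lemma refl_step_eq:
  "i < n \<Longrightarrow> refl_step f i x = x(i := x (nxt i) + x (prv i) - x i + f i - f (prv i))"
  by (auto simp: refl_step_def slope_def)

lemma refl_step_twice: "i < n \<Longrightarrow> refl_step f i (refl_step f i x) = x"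
  by (auto simp: refl_step_eq)

lemma refl_step_commute:
  assumes "i < n" "j < n" "mat i j = 2"
  shows "refl_step f i (refl_step f j x) = refl_step f j (refl_step f i x)"
proof -
  have "i \<noteq> j" "nxt i \<noteq> j" "nxt j \<noteq> i" "prv i \<noteq> j" "prv j \<noteq> i"
    using assms by (auto simp: mat_eq_2_iff)
  with assms show ?thesis by (auto simp: refl_step_eq fun_eq_iff)
qed

text \<open>Only the coordinates at \<open>i\<close> and \<open>nxt i\<close> change, and their
  outer neighbours enter as constants. So it does no harm that these two neighbours coincide when n
  = 3.\<close>

lemma refl_step_braid_nxt:
  assumes "i < n"
  shows "refl_step f i (refl_step f (nxt i) (refl_step f i x)) =
         refl_step f (nxt i) (refl_step f i (refl_step f (nxt i) x))"
proof -
  have "nxt i < n" "nxt (nxt i) \<noteq> nxt i" "nxt (nxt i) \<noteq> i" "prv i \<noteq> nxt i" "prv i \<noteq> i" "nxt i \<noteq> i"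
    using assms by simp_all
  then show ?thesis using assms by (auto simp: refl_step_eq fun_eq_iff)
qed

lemma refl_step_braid:
  assumes "i < n" "j < n" "mat i j = 3"
  shows "refl_step f i (refl_step f j (refl_step f i x)) =
         refl_step f j (refl_step f i (refl_step f j x))"
  using assms refl_step_braid_nxt[of i f x] refl_step_braid_nxt[of j f x]
  by (auto simp: mat_eq_3_iff)

lemma fold_refl_step_relator:
  assumes "s < n" "t < n"
  shows "fold (refl_step f) (concat (replicate (mat s t) [s, t])) x = x"
proof -
  note simps = refl_step_twice[OF assms(1)] refl_step_twice[OF assms(2)]
  consider "s = t" "mat s t = 1" | "mat s t = 2" | "mat s t = 3" using mat_cases by blast
  then show ?thesis
  proof cases
    case 1
    then show ?thesis using assms by (simp add: refl_step_twice)
  next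
    case 2
    then show ?thesis
      using refl_step_commute[OF assms 2] by (simp add: numeral_eq_Suc simps)
  next
    case 3
    then have "concat (replicate (mat s t) [s, t]) = [s, t, s, t, s, t]"
      by (simp add: numeral_eq_Suc)
    then show ?thesis
      using refl_step_braid[OF assms 3] by (simp add: simps)
  qed
qed

lemma cong_fold_refl_step: "cong u v \<Longrightarrow> fold (refl_step f) u = fold (refl_step f) v"
proof (induction rule: coxeter_cong.induct)
  case (relator u v s t)
  then show ?case by (auto simp: fold_refl_step_relator fun_eq_iff simp del: concat_replicate_trivial)
qed auto

definition path_vec :: "(nat \<Rightarrow> int) \<Rightarrow> (nat \<Rightarrow> int) \<Rightarrow> bool" where
  "path_vec f x \<longleftrightarrow> (\<forall>i<n. slope f x i = 1 \<or> slope f x i = -1)"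

lemma slope_refl_step:
  assumes "i < n" "j < n"
  shows "slope f (refl_step f i x) j =
    (if j = i then slope f x (prv i) else if j = prv i then slope f x i else slope f x j)"
  using assms by (auto simp: refl_step_def slope_def nxt_eq_iff)

lemma path_vec_refl_step: "i < n \<Longrightarrow> path_vec f x \<Longrightarrow> path_vec f (refl_step f i x)"
  by (auto simp: path_vec_def slope_refl_step)

lemma sum_refl_step:
  assumes "i < n"
  shows "(\<Sum>j<n. refl_step f i x j) = (\<Sum>j<n. x j) + slope f x i - slope f x (prv i)"
proof -
  have "(\<Sum>j<n. refl_step f i x j) = (\<Sum>j<n. x j + (if j = i then slope f x i - slope f x (prv i) else 0))"
    by (intro sum.cong) (auto simp: refl_step_def)
  then show ?thesis using assms by (simp add: sum.distrib)
qed

text \<open>Every letter meets a local minimum of the path, a slope -1 followed by a slope 1, which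
  is the only case in which a path vector gains 2.\<close>

fun ascending :: "(nat \<Rightarrow> int) \<Rightarrow> (nat \<Rightarrow> int) \<Rightarrow> nat list \<Rightarrow> bool" where
  "ascending f x [] \<longleftrightarrow> True"
| "ascending f x (i # u) \<longleftrightarrow>
     slope f x i = 1 \<and> slope f x (prv i) = -1 \<and> ascending f (refl_step f i x) u"

lemma sum_fold_refl_step_le:
  assumes "path_vec f x" "set u \<subseteq> {..<n}"
  shows "(\<Sum>j<n. fold (refl_step f) u x j) \<le> (\<Sum>j<n. x j) + 2 * int (length u)"
  using assms
proof (induction u arbitrary: x)
  case (Cons i u)
  then have "slope f x i - slope f x (prv i) \<le> 2"
    unfolding path_vec_def by (smt (verit) prv_less list.set_intros(1) lessThan_iff subsetD)
  moreover have "(\<Sum>j<n. fold (refl_step f) u (refl_step f i x) j) \<le>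
      (\<Sum>j<n. refl_step f i x j) + 2 * int (length u)"
    using Cons by (intro Cons.IH) (auto intro: path_vec_refl_step)
  ultimately show ?case using Cons.prems by (simp add: sum_refl_step)
qed simp

text \<open>A letter adds the difference of two slopes from {1, -1}. A total gain of twice the
  length leaves no slack, so each letter attains the maximum 2.\<close>

lemma ascending_if_sum_eq:
  assumes "path_vec f x" "set u \<subseteq> {..<n}"
    and "(\<Sum>j<n. fold (refl_step f) u x j) = (\<Sum>j<n. x j) + 2 * int (length u)"
  shows "ascending f x u"
  using assms
proof (induction u arbitrary: x)
  case (Cons i u)
  then have i: "i < n" "set u \<subseteq> {..<n}" by auto
  note pv = path_vec_refl_step[OF i(1) Cons.prems(1)]
  have "slope f x i = 1 \<or> slope f x i = -1" "slope f x (prv i) = 1 \<or> slope f x (prv i) = -1"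
    using Cons.prems(1) i by (auto simp: path_vec_def)
  moreover from sum_fold_refl_step_le[OF pv i(2)] Cons.prems(3)
  have "slope f x i - slope f x (prv i) \<ge> 2"
    by (simp add: sum_refl_step i)
  ultimately have *: "slope f x i = 1" "slope f x (prv i) = -1" by auto
  moreover have "ascending f (refl_step f i x) u"
    using Cons.prems(3) * by (intro Cons.IH pv i) (simp add: sum_refl_step i)
  ultimately show ?case by simp
qed simp

lemma fold_ascending:
  "ascending f x u \<Longrightarrow> fold (refl_step f) u x j = x j + 2 * int (count_list u j)"
proof (induction u arbitrary: x)
  case (Cons i u)
  then have eq: "fold (refl_step f) (i # u) x j = refl_step f i x j + 2 * int (count_list u j)"
    by simp
  show ?case unfolding eq using Cons.prems by (simp add: refl_step_def)
qed simp

end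

section \<open>Alternating words and the words attached to a height function\<close>

fun altw :: "'a \<Rightarrow> 'a \<Rightarrow> nat \<Rightarrow> 'a list" where
  "altw a b 0 = []"
| "altw a b (Suc k) = a # altw b a k"

lemma length_altw [simp]: "length (altw a b k) = k"
  by (induction k arbitrary: a b) auto

lemma count_list_altw:
  assumes "a \<noteq> b"
  shows "count_list (altw a b k) a = (k + 1) div 2 \<and> count_list (altw a b k) b = k div 2"
  using assms by (induction k arbitrary: a b) auto

lemma altw_snoc: "altw a b (Suc k) = altw a b k @ [if even k then a else b]"
proof (induction k arbitrary: a b)
  case (Suc k)
  have "altw a b (Suc (Suc k)) = a # altw b a (Suc k)" by simp
  also note Suc.IH
  finally show ?case by simp
qed simp

lemma rev_altw: "rev (altw a b k) = (if odd k then altw a b k else altw b a k)"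
proof (induction k arbitrary: a b)
  case (Suc k)
  have "rev (altw a b (Suc k)) = rev (altw b a k) @ [a]" by simp
  with Suc.IH[of b a] show ?case using altw_snoc[of a b k] altw_snoc[of b a k]
    by (auto simp del: altw.simps(2))
qed simp

lemma altw_palindrome:
  assumes "rev (altw a b k) = altw a b k" "a \<noteq> b"
  shows "odd k \<or> k = 0"
proof (rule ccontr)
  assume *: "\<not> (odd k \<or> k = 0)"
  with assms(1) have "altw b a k = altw a b k" by (simp add: rev_altw)
  with * assms(2) show False by (cases k) auto
qed

lemma distinct_adj_imp_altw:
  assumes "distinct_adj u" "set u \<subseteq> {a, b}"
  shows "u = altw a b (length u) \<or> u = altw b a (length u)"
  using assms
proof (induction u)
  case (Cons x u)
  then have IH: "u = altw a b (length u) \<or> u = altw b a (length u)"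
    by (auto dest: distinct_adj_ConsD)
  have "u = altw (if x = a then b else a) x (length u)"
  proof (cases u)
    case (Cons y v)
    with Cons.prems show ?thesis using IH by (auto split: if_splits)
  qed simp
  then show ?case using Cons.prems by (auto split: if_splits)
qed simp

context affine_A
begin

text \<open>An ascending word can use \<open>i\<close> only while the slope at \<open>i\<close> is
  1, and \<open>nxt i\<close> only while it is -1. Each use flips this sign and all other letters
  preserve it, so the two letters alternate and the initial slope decides which comes first.\<close>

lemma filter_edge_ascending:
  assumes "ascending f x u" "set u \<subseteq> {..<n}" "i < n" "path_vec f x"
  shows "\<exists>k. filter (\<lambda>y. y = i \<or> y = nxt i) u =
    (if slope f x i = 1 then altw i (nxt i) k else altw (nxt i) i k)"
  using assms
proof (induction u arbitrary: x)
  case Nil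
  then show ?case by (auto intro: exI[of _ 0])
next
  case (Cons j u)
  then have j: "j < n" by simp
  let ?F = "filter (\<lambda>y. y = i \<or> y = nxt i)"
  from Cons obtain k where k: "?F u =
      (if slope f (refl_step f j x) i = 1 then altw i (nxt i) k else altw (nxt i) i k)"
    by (metis ascending.simps(2) list.set_intros(2) path_vec_refl_step j subset_eq)
  consider "j = i" | "j = nxt i" | "j \<noteq> i" "j \<noteq> nxt i" by blast
  then show ?case
  proof cases
    case 1
    with Cons.prems k have "?F (j # u) = altw i (nxt i) (Suc k)" by (simp add: slope_refl_step)
    with 1 Cons.prems show ?thesis by (intro exI[of _ "Suc k"]) simp
  next
    case 2
    then have "slope f x i = -1" "slope f x j = 1" using Cons.prems by simp_all
    with 2 Cons.prems j k have "?F (j # u) = altw (nxt i) i (Suc k)" by (simp add: slope_refl_step)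
    with \<open>slope f x i = -1\<close> show ?thesis by (intro exI[of _ "Suc k"]) simp
  next
    case 3
    then have "slope f (refl_step f j x) i = slope f x i"
      using Cons.prems j by (auto simp: slope_refl_step)
    with k 3 show ?thesis by auto
  qed
qed

definition valid_heights :: "(nat \<Rightarrow> nat) \<Rightarrow> bool" where
  "valid_heights h \<longleftrightarrow> (\<forall>i<n. h (nxt i) = h i + 1 \<or> h i = h (nxt i) + 1 \<or> h i = 0 \<and> h (nxt i) = 0)"

text \<open>A word is described by its edge projections alone, which fixes it up to commutation. The
  generator of larger height comes first, as it has the one extra occurrence.\<close>

definition heights_word :: "(nat \<Rightarrow> nat) \<Rightarrow> nat list \<Rightarrow> bool" where
  "heights_word h u \<longleftrightarrow> set u \<subseteq> {..<n} \<and> (\<forall>i<n. filter (\<lambda>y. y = i \<or> y = nxt i) u =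
     (if h (nxt i) < h i then altw i (nxt i) (h i + h (nxt i)) else altw (nxt i) i (h i + h (nxt i))))"

text \<open>The offset that makes all slopes of \<open>bottom h\<close> equal to 1 or -1: horizontal
  steps on the axis count as slope 1, unit steps are left alone.\<close>

definition flat :: "(nat \<Rightarrow> nat) \<Rightarrow> nat \<Rightarrow> int" where
  "flat h i = (if h i = 0 \<and> h (nxt i) = 0 then 1 else 0)"

abbreviation bottom :: "(nat \<Rightarrow> nat) \<Rightarrow> nat \<Rightarrow> int" where
  "bottom h i \<equiv> - int (h i)"

lemma valid_heightsD:
  "valid_heights h \<Longrightarrow> i < n \<Longrightarrow> h (nxt i) = h i + 1 \<or> h i = h (nxt i) + 1 \<or> h i = 0 \<and> h (nxt i) = 0"
  by (auto simp: valid_heights_def)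

lemma slope_bottom: "slope (flat h) (bottom h) i = int (h i) - int (h (nxt i)) + flat h i"
  by (simp add: slope_def)

lemma path_vec_bottom: "valid_heights h \<Longrightarrow> path_vec (flat h) (bottom h)"
  unfolding path_vec_def by (auto simp: slope_bottom flat_def dest: valid_heightsD)

lemma count_list_filter: "P x \<Longrightarrow> count_list (filter P u) x = count_list u x"
  by (induction u) auto

lemma length_eq_sum_count:
  "set u \<subseteq> {..<n} \<Longrightarrow> length u = (\<Sum>i<n. count_list u i)"
  by (rule sum_count_set[symmetric]) auto

lemma length_filter_edge:
  "i < n \<Longrightarrow> length (filter (\<lambda>y. y = i \<or> y = nxt i) u) = count_list u i + count_list u (nxt i)"
  by (induction u) auto

text \<open>Unless both heights vanish, an edge projection has odd length, so its first letter, the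
  one of larger height, occurs once more than the other.\<close>

lemma heights_word_count:
  assumes "valid_heights h" "heights_word h u" "i < n"
  shows "count_list u i = h i"
proof -
  have "count_list u i = count_list (filter (\<lambda>y. y = i \<or> y = nxt i) u) i"
    by (simp add: count_list_filter)
  also have "\<dots> = h i"
    using assms valid_heightsD[OF assms(1,3)] count_list_altw[of i "nxt i"] count_list_altw[of "nxt i" i]
    by (auto simp: heights_word_def)
  finally show ?thesis .
qed

lemma heights_word_length:
  assumes "valid_heights h" "heights_word h u"
  shows "length u = (\<Sum>i<n. h i)"
  using assms by (simp add: length_eq_sum_count heights_word_count heights_word_def)

lemma heights_word_unique: "heights_word h u \<Longrightarrow> heights_word h v \<Longrightarrow> comm u v"
  by (rule commI_edges) (auto simp: heights_word_def)

text \<open>Alternating words of odd length are palindromes, so all edge projections survive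
  reversal.\<close>

lemma heights_word_rev:
  assumes "valid_heights h" "heights_word h u"
  shows "heights_word h (rev u)"
  using assms(2) unfolding heights_word_def
  by (auto simp: rev_filter[symmetric] rev_altw dest: valid_heightsD[OF assms(1)])

text \<open>Rising from \<open>-h i\<close> to \<open>h i\<close> in steps of 2 takes exactly
  \<open>h i\<close> letters \<open>i\<close>, and the slopes of \<open>bottom h\<close> tell which
  letter starts each edge projection.\<close>

lemma heights_word_if_ascending:
  assumes "valid_heights h" "ascending (flat h) (bottom h) u" "set u \<subseteq> {..<n}"
    and top: "\<And>i. i < n \<Longrightarrow> fold (refl_step (flat h)) u (bottom h) i = int (h i)"
  shows "heights_word h u"
proof -
  have count: "count_list u i = h i" if "i < n" for i
    using fold_ascending[OF assms(2), of i] top[OF that] by simp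
  have "filter (\<lambda>y. y = i \<or> y = nxt i) u =
      (if h (nxt i) < h i then altw i (nxt i) (h i + h (nxt i)) else altw (nxt i) i (h i + h (nxt i)))"
    if i: "i < n" for i
  proof -
    let ?F = "filter (\<lambda>y. y = i \<or> y = nxt i) u"
    have len: "length ?F = h i + h (nxt i)"
      by (simp add: length_filter_edge i count)
    obtain k where k: "?F = (if slope (flat h) (bottom h) i = 1 then altw i (nxt i) k else altw (nxt i) i k)"
      using filter_edge_ascending[OF assms(2,3) i path_vec_bottom[OF assms(1)]] by blast
    then have "length ?F = k" by simp
    with len have "k = h i + h (nxt i)" by simp
    with k valid_heightsD[OF assms(1) i] show ?thesis
      by (auto simp: slope_bottom flat_def)
  qed
  with assms(3) show ?thesis by (simp add: heights_word_def)
qed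

text \<open>
  A coordinate still below its target, of minimal value among these, is a local minimum of the
  path, so that its generator raises it.
\<close>

lemma ascending_to_top:
  assumes "valid_heights h" "path_vec (flat h) x"
    and "\<And>i. i < n \<Longrightarrow> - int (h i) \<le> x i \<and> x i \<le> int (h i) \<and> even (int (h i) - x i)"
  shows "\<exists>u. set u \<subseteq> {..<n} \<and> ascending (flat h) x u \<and>
    (\<forall>i<n. fold (refl_step (flat h)) u x i = int (h i))"
  using assms(2,3)
proof (induction "nat (\<Sum>i<n. int (h i) - x i)" arbitrary: x rule: less_induct)
  case less
  define D where "D = {i. i < n \<and> x i < int (h i)}"
  have "finite D" by (simp add: D_def)
  show ?case
  proof (cases "D = {}")
    case True
    then have "x i = int (h i)" if "i < n" for i
      using less.prems(2)[OF that] that by (force simp: D_def)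
    then show ?thesis by (intro exI[of _ "[]"]) simp
  next
    case False
    then obtain i where "i \<in> D" and min: "\<And>j. j \<in> D \<Longrightarrow> x i \<le> x j"
      using arg_min_if_finite[OF \<open>finite D\<close> False, of x] by (metis not_le)
    then have i: "i < n" "x i < int (h i)" by (auto simp: D_def)
    have pv: "slope (flat h) x j = 1 \<or> slope (flat h) x j = -1" if "j < n" for j
      using less.prems(1) that by (auto simp: path_vec_def)
    have bounds: "- int (h j) \<le> x j" "x j \<le> int (h j)" "even (int (h j) - x j)" if "j < n" for j
      using less.prems(2)[OF that] by auto
    \<comment> \<open>By parity the gap to the target is at least 2, so the raise does not
      overshoot.\<close>
    have below: "x i + 2 \<le> int (h i)"
      using bounds[OF i(1)] i by presburger
    have right: "slope (flat h) x i = 1"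
    proof (rule ccontr)
      assume "\<not> ?thesis"
      with pv[OF i(1)] have s: "slope (flat h) x i = -1" by blast
      \<comment> \<open>A positive height means that no edge at \<open>i\<close> is flat, so slopes
        at \<open>i\<close> are plain differences. Since \<open>x i\<close> is at least 2 short of
        its target and \<open>h\<close> falls by at most 1, a lower neighbour would be below its
        target too, against minimality.\<close>
      have "h i > 0" using bounds[OF i(1)] i by linarith
      then have x: "x (nxt i) = x i - 1" using s by (simp add: slope_def flat_def)
      with valid_heightsD[OF assms(1) i(1)] \<open>h i > 0\<close> below have "nxt i \<in> D" by (auto simp: D_def)
      from min[OF this] x show False by simp
    qed
    have left: "slope (flat h) x (prv i) = -1"
    proof (rule ccontr)
      assume "\<not> ?thesis"
      with pv[of "prv i"] have s: "slope (flat h) x (prv i) = 1" by simp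
      have "h i > 0" using bounds[OF i(1)] i by linarith
      then have x: "x (prv i) = x i - 1" using s i by (simp add: slope_def flat_def)
      with valid_heightsD[OF assms(1), of "prv i"] \<open>h i > 0\<close> i below have "prv i \<in> D" by (auto simp: D_def)
      from min[OF this] x show False by simp
    qed
    let ?y = "refl_step (flat h) i x"
    have y: "?y j = (if j = i then x i + 2 else x j)" for j
      using left right by (simp add: refl_step_def)
    have nonneg: "(\<Sum>j<n. int (h j) - ?y j) \<ge> 0"
      by (intro sum_nonneg) (use y bounds below in auto)
    have "(\<Sum>j<n. ?y j) = (\<Sum>j<n. x j) + 2"
      by (simp add: sum_refl_step i left right)
    then have "nat (\<Sum>j<n. int (h j) - ?y j) < nat (\<Sum>j<n. int (h j) - x j)"
      using nonneg by (simp add: sum_subtractf)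
    moreover have "path_vec (flat h) ?y" by (rule path_vec_refl_step[OF i(1) less.prems(1)])
    moreover have "- int (h j) \<le> ?y j \<and> ?y j \<le> int (h j) \<and> even (int (h j) - ?y j)" if "j < n" for j
      using bounds[OF that] below y by (auto simp: algebra_simps)
    ultimately obtain u where u: "set u \<subseteq> {..<n}" "ascending (flat h) ?y u"
        "\<forall>j<n. fold (refl_step (flat h)) u ?y j = int (h j)"
      using less.hyps[of ?y] by blast
    then show ?thesis using i left right by (intro exI[of _ "i # u"]) simp
  qed
qed

lemma ascending_bottom_to_top:
  assumes "valid_heights h"
  obtains u where "set u \<subseteq> {..<n}" "ascending (flat h) (bottom h) u"
    "\<And>i. i < n \<Longrightarrow> fold (refl_step (flat h)) u (bottom h) i = int (h i)"
  using ascending_to_top[OF assms path_vec_bottom[OF assms]] by auto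

lemma heights_word_exists:
  assumes "valid_heights h"
  shows "\<exists>u. heights_word h u"
proof -
  from ascending_bottom_to_top[OF assms] obtain u where "set u \<subseteq> {..<n}"
    "ascending (flat h) (bottom h) u"
    "\<And>i. i < n \<Longrightarrow> fold (refl_step (flat h)) u (bottom h) i = int (h i)" by blast
  then have "heights_word h u" by (intro heights_word_if_ascending assms)
  then show ?thesis ..
qed

text \<open>The word \<open>u\<close> is not known to be ascending, but it is commutation equivalent
  to an ascending word \<open>a\<close> with the same projections. Hence \<open>v\<close> acts like
  \<open>a\<close> and lifts \<open>-h\<close> to \<open>h\<close>, a gain of
  \<open>2 * length u\<close>. This bounds \<open>length v\<close> from below, and equality makes
  \<open>v\<close> ascending.\<close>

lemma heights_word_cong_minimal:
  assumes "valid_heights h" "heights_word h u" "cong u v"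
  shows "length u \<le> length v \<and> (length v = length u \<longrightarrow> heights_word h v)"
proof -
  let ?f = "flat h" and ?x = "bottom h"
  from ascending_bottom_to_top[OF assms(1)] obtain a where a: "set a \<subseteq> {..<n}"
    "ascending ?f ?x a" "\<And>i. i < n \<Longrightarrow> fold (refl_step ?f) a ?x i = int (h i)" by blast
  then have "heights_word h a" by (intro heights_word_if_ascending assms)
  then have "cong a u" using heights_word_unique[of h a u] assms(2) a(1) by (intro comm_imp_cong)
  with assms(3) have av: "cong a v" by (meson coxeter_cong.trans)
  then have v: "set v \<subseteq> {..<n}" by (auto dest: coxeter_cong_lists)
  have top: "fold (refl_step ?f) v ?x i = int (h i)" if "i < n" for i
    using a(3)[OF that] cong_fold_refl_step[OF av] by simp
  have len: "length u = (\<Sum>i<n. h i)" using assms heights_word_length by blast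
  have top_sum: "(\<Sum>i<n. fold (refl_step ?f) v ?x i) = (\<Sum>i<n. ?x i) + 2 * int (length u)"
    by (simp add: top len sum_negf)
  have "length u \<le> length v"
    using sum_fold_refl_step_le[OF path_vec_bottom[OF assms(1)] v] top_sum by simp
  moreover have "heights_word h v" if "length v = length u"
  proof (rule heights_word_if_ascending[OF assms(1) _ v top])
    show "ascending ?f ?x v"
      using top_sum that by (intro ascending_if_sum_eq path_vec_bottom assms v) simp
  qed
  ultimately show ?thesis by blast
qed

text \<open>All reduced words share their edge projections, hence are commutation equivalent. Since
  \<open>rev u\<close>, which represents the inverse, has these projections as well, the element is
  an involution.\<close>

lemma heights_word_class:
  assumes "valid_heights h" "heights_word h u"
  defines "w \<equiv> coxeter_class {..<n} mat u"
  shows "w \<in> affine_A_fc_involutions n" "reduced_words w = {v. heights_word h v}"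
    "coxeter_length w = (\<Sum>i<n. h i)"
proof -
  have u: "u \<in> lists {..<n}" "set u \<subseteq> {..<n}" using assms(2) by (auto simp: heights_word_def)
  have carr: "w \<in> carrier (coxeter_group {..<n} mat)"
    using u by (auto simp: w_def carrier_coxeter_group)
  have mem: "u \<in> w" using u by (simp add: w_def coxeter_rel_def coxeter_cong.refl)
  have min: "length u \<le> length v" "length v = length u \<Longrightarrow> heights_word h v" if "v \<in> w" for v
    using that heights_word_cong_minimal[OF assms(1,2)] by (auto simp: w_def coxeter_rel_def)
  have len: "coxeter_length w = length u"
    unfolding coxeter_length_def by (rule Least_equality) (use mem min(1) in auto)
  then show "coxeter_length w = (\<Sum>i<n. h i)" by (simp add: heights_word_length[OF assms(1,2)])
  have heights_word_mem: "v \<in> w" if "heights_word h v" for v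
    using comm_imp_cong[OF heights_word_unique[OF assms(2) that] u(2)] by (simp add: w_def coxeter_rel_def)
  show red: "reduced_words w = {v. heights_word h v}"
    using heights_word_mem min(2) heights_word_length[OF assms(1)] assms(2) by (auto simp: reduced_words_def len)
  have "fully_commutative mat w"
    unfolding fully_commutative_def red using heights_word_unique by blast
  moreover have "w \<otimes>\<^bsub>coxeter_group {..<n} mat\<^esub> w = \<one>\<^bsub>coxeter_group {..<n} mat\<^esub>"
  proof -
    have "cong u (rev u)"
      by (intro comm_imp_cong heights_word_unique[OF assms(2) heights_word_rev[OF assms(1,2)]] u)
    then have "cong (u @ u) (u @ rev u)" using u by (intro coxeter_cong_append_left)
    moreover have "cong (u @ rev u) []" using u by (intro coxeter_cong_rev_append) auto
    ultimately have "cong (u @ u) []" by (rule coxeter_cong.trans)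
    then show ?thesis using u
      by (simp only: w_def coxeter_mult_class coxeter_class_eq) (simp add: coxeter_group_def)
  qed
  ultimately show "w \<in> affine_A_fc_involutions n"
    using carr by (simp add: affine_A_fc_involutions_def fc_involutions_def)
qed

end

section \<open>From fully commutative involutions to height functions\<close>

lemma filter_eq_consecutive:
  assumes "filter P u = xs @ y # y # ys"
  shows "\<exists>a b c. u = a @ y # b @ y # c \<and> P y \<and> (\<forall>x\<in>set b. \<not> P x)"
  using assms
proof (induction u arbitrary: xs)
  case (Cons z u)
  show ?case
  proof (cases "P z \<and> xs = []")
    case True
    with Cons.prems have "z = y" "filter P u = y # ys" by auto
    then obtain b c where "u = b @ y # c" "\<forall>x\<in>set b. \<not> P x"
      by (auto simp: filter_eq_Cons_iff)
    with True \<open>z = y\<close> show ?thesis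
      by (intro exI[of _ "[]"] exI[of _ b] exI[of _ c]) auto
  next
    case False
    then obtain xs' where "filter P u = xs' @ y # y # ys"
      using Cons.prems by (cases xs) (auto split: if_splits)
    from Cons.IH[OF this] obtain a b c where "u = a @ y # b @ y # c" "P y" "\<forall>x\<in>set b. \<not> P x"
      by blast
    then show ?thesis by (intro exI[of _ "z # a"] exI[of _ b] exI[of _ c]) auto
  qed
qed simp

lemma not_distinct_adj_decomp:
  "\<not> distinct_adj u \<Longrightarrow> \<exists>xs y ys. u = xs @ y # y # ys"
proof (induction u)
  case (Cons x u)
  then obtain y v where u: "u = y # v" by (cases u) auto
  show ?case
  proof (cases "x = y")
    case True
    with u show ?thesis by (intro exI[of _ "[]"]) auto
  next
    case False
    with Cons u obtain xs z ys where "u = xs @ z # z # ys" by auto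
    then show ?thesis by (intro exI[of _ "x # xs"]) auto
  qed
qed simp

lemma altw_larger_first:
  assumes "w = altw a b (p + q) \<and> (p = q + 1 \<or> p + q = 0) \<or>
    w = altw b a (p + q) \<and> (q = p + 1 \<or> p + q = 0)"
  shows "(q = p + 1 \<or> p = q + 1 \<or> p = 0 \<and> q = 0) \<and>
    w = (if q < p then altw a b (p + q) else altw b a (p + q))"
  using assms by auto

lemma halves:
  fixes p q :: nat
  assumes "p = (k + 1) div 2" "odd k \<or> k = 0" "p + q = k"
  shows "p = q + 1 \<or> k = 0"
  using assms by presburger

context affine_A
begin

definition nbr :: "nat \<Rightarrow> nat \<Rightarrow> bool" where
  "nbr i x \<longleftrightarrow> i \<noteq> x \<and> (x = nxt i \<or> i = nxt x)"

lemma mat_eq_2: "i \<noteq> x \<Longrightarrow> \<not> nbr i x \<Longrightarrow> mat i x = 2" "i \<noteq> x \<Longrightarrow> \<not> nbr i x \<Longrightarrow> mat x i = 2"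
  by (auto simp: nbr_def mat_eq_2_iff)

text \<open>
  With at most one neighbour between two occurrences of \<open>i\<close>, commutations bring about a factor
  \<open>ii\<close>, which cancels, or a factor \<open>iti\<close>, and a braid move would change the multiset of letters.
\<close>

lemma fc_two_neighbours:
  assumes w: "w \<in> carrier (coxeter_group {..<n} mat)" "fully_commutative mat w"
    and u: "u \<in> reduced_words w" "u = a @ i # b @ i # c" and i: "i \<notin> set b"
  shows "length (filter (nbr i) b) \<ge> 2"
proof (rule ccontr)
  assume "\<not> ?thesis"
  then have le: "length (filter (nbr i) b) \<le> 1" by simp
  have ul: "u \<in> lists {..<n}" "set u \<subseteq> {..<n}"
    using carrier_eq_coxeter_class(2)[OF w(1)] u(1) by (auto simp: reduced_words_def)
  show False
  proof (cases "filter (nbr i) b")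
    case Nil
    then have "\<forall>x\<in>set b. mat i x = 2"
      using i by (auto simp: filter_empty_conv intro!: mat_eq_2(1))
    from commutation_steps_append_left[OF commutation_steps_append_right[OF
        commutation_steps_shift_right[of b mat i, OF this], of "i # c"], of a]
    have "comm u (a @ b @ i # i # c)" by (simp add: u(2))
    then have "cong u (a @ b @ i # i # c)" using ul by (intro comm_imp_cong)
    moreover have "cong ((a @ b) @ i # i # c) ((a @ b) @ c)"
      using ul by (intro coxeter_cong_cancel) (auto simp: u(2))
    ultimately have "cong u (a @ b @ c)" by simp (meson coxeter_cong.trans)
    from reduced_words_not_shorter[OF w(1) u(1) this] show False by (simp add: u(2))
  next
    case (Cons t ts)
    with le have "filter (nbr i) b = [t]" by simp
    then obtain b1 b2 where b: "b = b1 @ t # b2" "nbr i t"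
      "\<forall>x\<in>set b1. \<not> nbr i x" "filter (nbr i) b2 = []"
      by (auto simp: filter_eq_Cons_iff)
    have b1: "\<forall>x\<in>set b1. mat i x = 2"
      using i b by (auto intro!: mat_eq_2(1))
    have b2: "\<forall>x\<in>set b2. mat x i = 2"
      using i b by (auto simp: filter_empty_conv intro!: mat_eq_2(2))
    let ?v = "a @ b1 @ [i, t, i] @ b2 @ c" and ?v' = "a @ b1 @ [t, i, t] @ b2 @ c"
    have "comm u (a @ b1 @ [i, t] @ b2 @ i # c)"
      using commutation_steps_append_left[OF commutation_steps_append_right[OF
        commutation_steps_shift_right[of b1 mat i, OF b1], of "t # b2 @ i # c"], of a] by (simp add: u(2) b)
    also have "comm (a @ b1 @ [i, t] @ b2 @ i # c) ?v"
      using commutation_steps_append_left[OF commutation_steps_append_right[OF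
        commutation_steps_shift_left[of b2 mat i, OF b2], of c], of "a @ b1 @ [i, t]"] by simp
    finally have "comm u ?v" .
    then have "mset u = mset ?v" "cong u ?v"
      using ul by (auto intro: comm_imp_cong dest: commutation_steps_mset)
    moreover have "cong ((a @ b1) @ [i, t, i] @ b2 @ c) ((a @ b1) @ [t, i, t] @ b2 @ c)"
      using ul b by (intro coxeter_cong_context coxeter_cong_braid) (auto simp: u(2) nbr_def mat_eq_3_iff)
    ultimately have "cong u ?v'" by simp (meson coxeter_cong.trans)
    then have "?v' \<in> reduced_words w"
      by (rule reduced_words_cong[OF w(1) u(1)]) (simp add: u(2) b)
    with w(2) u(1) have "comm u ?v'" by (auto simp: fully_commutative_def)
    from commutation_steps_mset[OF this] \<open>mset u = mset ?v\<close> have "mset ?v = mset ?v'" by simp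
    then have "count_list ?v i = count_list ?v' i" by (metis count_mset)
    then have "i = t" by (auto split: if_splits)
    with b(2) show False by (simp add: nbr_def)
  qed
qed

text \<open>
  Two consecutive \<open>g 1\<close> without \<open>g 0\<close> in between enclose two consecutive \<open>g 2\<close> without \<open>g 1\<close> in
  between, and so on around the cycle until \<open>g n = g 0\<close>.
\<close>

lemma fc_no_gap:
  assumes w: "w \<in> carrier (coxeter_group {..<n} mat)" "fully_commutative mat w"
    and u: "u \<in> reduced_words w" "u = a @ g 1 # b @ g 1 # c" "g 1 \<notin> set b" "g 0 \<notin> set b"
    and g: "\<And>k x. x < n \<Longrightarrow> nbr (g (Suc k)) x \<Longrightarrow> x = g k \<or> x = g (Suc (Suc k))" "g n = g 0"
  shows False
proof -
  have us: "set u \<subseteq> {..<n}"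
    using carrier_eq_coxeter_class(2)[OF w(1)] u(1) by (auto simp: reduced_words_def)
  have gap: "g (Suc (Suc k)) \<in> set b \<and>
      (\<exists>a' b' c'. b = a' @ g (Suc (Suc k)) # b' @ g (Suc (Suc k)) # c' \<and>
         g (Suc (Suc k)) \<notin> set b')"
    if dec: "u = a @ g (Suc k) # b @ g (Suc k) # c" "g (Suc k) \<notin> set b" "g k \<notin> set b" for k a b c
  proof -
    let ?y = "g (Suc (Suc k))"
    have "filter (nbr (g (Suc k))) b = filter (\<lambda>x. nbr (g (Suc k)) x \<and> x = ?y) b"
      using dec us g(1)[of _ k] by (intro filter_cong) auto
    also have "\<forall>x\<in>set \<dots>. x = ?y" by simp
    finally have "\<forall>x\<in>set (filter (nbr (g (Suc k))) b). x = ?y" .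
    moreover obtain x y zs where xy: "filter (nbr (g (Suc k))) b = x # y # zs"
      using fc_two_neighbours[OF w u(1) dec(1,2)]
      by (cases "filter (nbr (g (Suc k))) b" rule: remdups_adj.cases) auto
    ultimately have xy: "filter (nbr (g (Suc k))) b = [] @ ?y # ?y # zs" by simp
    from filter_eq_consecutive[OF this] obtain a' b' c'
      where "b = a' @ ?y # b' @ ?y # c'" "nbr (g (Suc k)) ?y" "\<forall>x\<in>set b'. \<not> nbr (g (Suc k)) x"
      by blast
    then show ?thesis by auto
  qed
  \<comment> \<open>The segments are nested, so the absence of \<open>g 0\<close> passes from each
    to the next. It is what the end of the tour around the cycle contradicts.\<close>
  have P: "\<exists>a b c. u = a @ g (Suc k) # b @ g (Suc k) # c \<and> g (Suc k) \<notin> set b \<and> g k \<notin> set b \<and> g 0 \<notin> set b" for k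
  proof (induction k)
    case 0
    with u show ?case by auto
  next
    case (Suc k)
    then obtain a b c where *: "u = a @ g (Suc k) # b @ g (Suc k) # c"
      "g (Suc k) \<notin> set b" "g k \<notin> set b" "g 0 \<notin> set b" by blast
    from gap[OF *(1-3)] obtain a' b' c' where
      "b = a' @ g (Suc (Suc k)) # b' @ g (Suc (Suc k)) # c'" "g (Suc (Suc k)) \<notin> set b'" by blast
    with * show ?case
      by (intro exI[of _ "a @ g (Suc k) # a'"] exI[of _ b'] exI[of _ "c' @ g (Suc k) # c"]) simp
  qed
  \<comment> \<open>For this index the enclosed generator \<open>g (Suc (Suc k))\<close> is
    \<open>g n = g 0\<close>.\<close>
  define k where "k = n - 2"
  have "Suc (Suc k) = n" using n_ge_3 by (simp add: k_def)
  from P[of k] gap[of _ k] show False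
    unfolding \<open>Suc (Suc k) = n\<close> g(2) by blast
qed

lemma nxt_funpow: "i < n \<Longrightarrow> (nxt ^^ k) i = (i + k) mod n"
  by (induction k) (simp_all add: nxt_def mod_Suc_eq)

lemma prv_funpow: "i < n \<Longrightarrow> (prv ^^ k) i = (i + k * (n - 1)) mod n"
proof (induction k)
  case (Suc k)
  have "(prv ^^ Suc k) i = ((i + k * (n - 1)) mod n + (n - 1)) mod n"
    by (simp only: funpow.simps o_apply Suc.IH[OF Suc.prems] prv_def)
  also have "\<dots> = (i + k * (n - 1) + (n - 1)) mod n" by (rule mod_add_left_eq)
  finally show ?case by (simp only: mult_Suc add_ac)
qed simp

text \<open>The tour starts at the missing neighbour \<open>nxt i\<close> and runs downwards, so
  that \<open>g 0 = nxt i\<close> and \<open>g 1 = i\<close>. The next lemma, with the roles of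
  \<open>i\<close> and \<open>nxt i\<close> exchanged, runs upwards.\<close>

lemma fc_no_gap_nxt:
  assumes "w \<in> carrier (coxeter_group {..<n} mat)" "fully_commutative mat w"
    and "u \<in> reduced_words w" "u = a @ i # b @ i # c" "i \<notin> set b" "nxt i \<notin> set b" "i < n"
  shows False
proof (rule fc_no_gap[OF assms(1-3)])
  let ?g = "\<lambda>k. (prv ^^ k) (nxt i)"
  have less: "?g k < n" for k by (cases k) auto
  show "u = a @ ?g 1 # b @ ?g 1 # c" "?g 1 \<notin> set b" "?g 0 \<notin> set b"
    using assms by simp_all
  show "x = ?g k \<or> x = ?g (Suc (Suc k))" if "x < n" "nbr (?g (Suc k)) x" for k x
    using that less[of k] by (auto simp: nbr_def)
  show "?g n = ?g 0" by (simp add: prv_funpow)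
qed

lemma fc_no_gap_prv:
  assumes "w \<in> carrier (coxeter_group {..<n} mat)" "fully_commutative mat w"
    and "u \<in> reduced_words w" "u = a @ nxt i # b @ nxt i # c" "i \<notin> set b" "nxt i \<notin> set b" "i < n"
  shows False
proof (rule fc_no_gap[OF assms(1-3)])
  let ?g = "\<lambda>k. (nxt ^^ k) i"
  have less: "?g k < n" for k using assms by (cases k) auto
  show "u = a @ ?g 1 # b @ ?g 1 # c" "?g 1 \<notin> set b" "?g 0 \<notin> set b"
    using assms by simp_all
  show "x = ?g k \<or> x = ?g (Suc (Suc k))" if "x < n" "nbr (?g (Suc k)) x" for k x
    using that less[of k] by (auto simp: nbr_def nxt_eq_iff)
  show "?g n = ?g 0" using assms(7) by (simp add: nxt_funpow)
qed

text \<open>The reversal of \<open>u\<close> is again a reduced word of the involution, so full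
  commutativity makes the edge projections palindromes. Having no gaps they alternate, and an
  alternating palindrome is empty or of odd length, which fixes the difference of the two
  counts.\<close>

lemma fc_involution_heights_word:
  assumes w: "w \<in> affine_A_fc_involutions n" and u: "u \<in> reduced_words w"
  shows "valid_heights (count_list u) \<and> heights_word (count_list u) u"
proof -
  have carr: "w \<in> carrier (coxeter_group {..<n} mat)" and fc: "fully_commutative mat w"
    and inv: "w \<otimes>\<^bsub>coxeter_group {..<n} mat\<^esub> w = \<one>\<^bsub>coxeter_group {..<n} mat\<^esub>"
    using w by (auto simp: affine_A_fc_involutions_def fc_involutions_def)
  have wu: "w = coxeter_class {..<n} mat u" and ul: "u \<in> lists {..<n}"
    using carrier_eq_coxeter_class[OF carr] u by (auto simp: reduced_words_def)
  then have us: "set u \<subseteq> {..<n}" by auto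
  have "coxeter_class {..<n} mat (u @ u) = coxeter_class {..<n} mat []"
    using inv ul by (simp only: wu coxeter_mult_class) (simp add: coxeter_group_def)
  then have "cong (u @ u) []" by (rule coxeter_class_eqD) simp
  then have "cong ((u @ u) @ rev u) ([] @ rev u)"
    by (rule coxeter_cong_append_right) (use us in auto)
  moreover have "cong (u @ (u @ rev u)) (u @ [])"
    using ul by (intro coxeter_cong_append_left coxeter_cong_rev_append) auto
  \<comment> \<open>The word \<open>u u (rev u)\<close> reduces to \<open>rev u\<close> because
    \<open>u u\<close> is trivial, and to \<open>u\<close> because \<open>u (rev u)\<close>
    is.\<close>
  ultimately have "cong u (rev u)" by simp (meson coxeter_cong.sym coxeter_cong.trans)
  then have "rev u \<in> reduced_words w" by (rule reduced_words_cong[OF carr u]) simp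
  with fc u have comm: "comm u (rev u)" by (auto simp: fully_commutative_def)
  have edge: "(count_list u (nxt i) = count_list u i + 1 \<or> count_list u i = count_list u (nxt i) + 1 \<or>
        count_list u i = 0 \<and> count_list u (nxt i) = 0) \<and>
      filter (\<lambda>y. y = i \<or> y = nxt i) u =
      (if count_list u (nxt i) < count_list u i
       then altw i (nxt i) (count_list u i + count_list u (nxt i))
       else altw (nxt i) i (count_list u i + count_list u (nxt i)))"
    if i: "i < n" for i
  proof -
    let ?P = "\<lambda>y. y = i \<or> y = nxt i" and ?k = "count_list u i + count_list u (nxt i)"
    have "distinct_adj (filter ?P u)"
    proof (rule ccontr)
      assume "\<not> ?thesis"
      then obtain xs y ys where F: "filter ?P u = xs @ y # y # ys"
        using not_distinct_adj_decomp[of "filter ?P u"] by blast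
      obtain a b c where *: "u = a @ y # b @ y # c" "?P y" "\<forall>x\<in>set b. \<not> ?P x"
        using filter_eq_consecutive[OF F] by metis
      from *(2) show False
      proof
        assume "y = i"
        with * i show False using fc_no_gap_nxt[OF carr fc u, of a i b c] by auto
      next
        assume "y = nxt i"
        with * i show False using fc_no_gap_prv[OF carr fc u, of a i b c] by auto
      qed
    qed
    moreover have "length (filter ?P u) = ?k" by (rule length_filter_edge[OF i])
    ultimately have alt: "filter ?P u = altw i (nxt i) ?k \<or> filter ?P u = altw (nxt i) i ?k"
      using distinct_adj_imp_altw[of "filter ?P u" i "nxt i"] by auto
    have "filter ?P u = filter ?P (rev u)"
      by (rule commutation_steps_filter[OF comm]) (auto simp: mat_eq_2_iff)
    then have rev: "rev (filter ?P u) = filter ?P u" by (simp add: rev_filter)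
    have count: "count_list (filter ?P u) i = count_list u i"
      "count_list (filter ?P u) (nxt i) = count_list u (nxt i)"
      by (simp_all add: count_list_filter)
    from alt show ?thesis
    proof
      assume F: "filter ?P u = altw i (nxt i) ?k"
      have k: "odd ?k \<or> ?k = 0"
        by (rule altw_palindrome[OF rev[unfolded F]]) (use i in simp)
      have "count_list u i = count_list (altw i (nxt i) ?k) i"
        by (rule count(1)[unfolded F, symmetric])
      also have "\<dots> = (?k + 1) div 2"
        by (rule count_list_altw[THEN conjunct1]) (simp add: i)
      finally have "count_list u i = (?k + 1) div 2" .
      then have "count_list u i = count_list u (nxt i) + 1 \<or> ?k = 0"
        using k by (rule halves) (rule HOL.refl)
      with F show ?thesis by (intro altw_larger_first[OF disjI1[OF conjI]])
    next
      assume F: "filter ?P u = altw (nxt i) i ?k"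
      have k: "odd ?k \<or> ?k = 0"
        by (rule altw_palindrome[OF rev[unfolded F]]) (use i in simp)
      have "count_list u (nxt i) = count_list (altw (nxt i) i ?k) (nxt i)"
        by (rule count(2)[unfolded F, symmetric])
      also have "\<dots> = (?k + 1) div 2"
        by (rule count_list_altw[THEN conjunct1]) (simp add: i)
      finally have "count_list u (nxt i) = (?k + 1) div 2" .
      then have "count_list u (nxt i) = count_list u i + 1 \<or> ?k = 0"
        using k by (rule halves) (rule add.commute)
      with F show ?thesis by (intro altw_larger_first[OF disjI2[OF conjI]])
    qed
  qed
  show ?thesis unfolding valid_heights_def heights_word_def
    by (intro conjI allI impI us edge[THEN conjunct1] edge[THEN conjunct2])
qed

end

section \<open>Generating functions of walks\<close>

lemma gen_fun_finite:
  assumes "finite A"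
  shows "gen_fun A wt = (\<Sum>a\<in>A. fps_X ^ wt a)"
proof (rule fps_ext)
  fix k
  have "of_nat (card {x \<in> A. wt x = k}) = (\<Sum>a\<in>A. if wt a = k then 1 else (0 :: rat))"
    using assms by (simp add: sum.If_cases Int_def)
  also have "\<dots> = (\<Sum>a\<in>A. fps_nth (fps_X ^ wt a) k)"
    by (intro sum.cong) (auto simp: fps_X_power_iff)
  finally show "fps_nth (gen_fun A wt) k = fps_nth (\<Sum>a\<in>A. fps_X ^ wt a) k"
    by (simp add: gen_fun_def fps_sum_nth)
qed

lemma gen_fun_bij_betw:
  assumes "bij_betw f A B" "\<And>a. a \<in> A \<Longrightarrow> wt' (f a) = wt a"
  shows "gen_fun A wt = gen_fun B wt'"
proof (rule fps_ext)
  fix k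
  have "bij_betw f {a \<in> A. wt a = k} {b \<in> B. wt' b = k}"
    using assms unfolding bij_betw_def by (auto simp: inj_on_def)
  then show "fps_nth (gen_fun A wt) k = fps_nth (gen_fun B wt') k"
    by (simp add: gen_fun_def bij_betw_same_card)
qed

text \<open>Finite fibres are required because \<open>card\<close> is 0 on infinite sets and then
  fails to be additive.\<close>

lemma gen_fun_Un:
  assumes "A \<inter> B = {}" "\<And>k. finite {x \<in> A \<union> B. wt x = k}"
  shows "gen_fun (A \<union> B) wt = gen_fun A wt + gen_fun B wt"
proof (rule fps_ext)
  fix k
  have "{x \<in> A \<union> B. wt x = k} = {x \<in> A. wt x = k} \<union> {x \<in> B. wt x = k}" by auto
  moreover have "card \<dots> = card {x \<in> A. wt x = k} + card {x \<in> B. wt x = k}"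
    using assms(1) assms(2)[of k]
    by (intro card_Un_disjoint) (auto elim: rev_finite_subset)
  ultimately show "fps_nth (gen_fun (A \<union> B) wt) k = fps_nth (gen_fun A wt + gen_fun B wt) k"
    by (simp add: gen_fun_def)
qed

lemma gen_fun_cong:
  "A = B \<Longrightarrow> (\<And>x. x \<in> B \<Longrightarrow> wt x = wt' x) \<Longrightarrow> gen_fun A wt = gen_fun B wt'"
  by (rule gen_fun_bij_betw[of id]) auto

lemma gen_fun_shift:
  assumes "\<And>x. x \<in> A \<Longrightarrow> wt' x = wt x + c"
  shows "gen_fun A wt' = fps_X ^ c * gen_fun A wt"
proof (rule fps_ext)
  fix k
  have "{x \<in> A. wt' x = k} = (if k < c then {} else {x \<in> A. wt x = k - c})"
    using assms by auto
  then show "fps_nth (gen_fun A wt') k = fps_nth (fps_X ^ c * gen_fun A wt) k"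
    by (simp add: gen_fun_def fps_X_power_mult_nth)
qed

lemma gen_fun_polynomial:
  assumes "finite A"
  shows "\<exists>p. gen_fun A wt = fps_of_poly p"
  using assms
  by (intro exI[of _ "\<Sum>a\<in>A. monom 1 (wt a)"])
     (simp add: gen_fun_finite fps_of_poly_sum fps_of_poly_monom)

section \<open>Walks with horizontal steps on the axis\<close>

definition unit_step :: "nat \<Rightarrow> nat \<Rightarrow> bool" where
  "unit_step a b \<longleftrightarrow> b = a + 1 \<or> a = b + 1"

definition floor_step :: "nat \<Rightarrow> nat \<Rightarrow> bool" where
  "floor_step a b \<longleftrightarrow> unit_step a b \<or> a = 0 \<and> b = 0"

lemma unit_step_0 [simp]: "unit_step 0 b \<longleftrightarrow> b = 1" "unit_step a 0 \<longleftrightarrow> a = 1"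
  by (auto simp: unit_step_def)

lemma unit_step_Suc [simp]: "unit_step (Suc a) (Suc b) = unit_step a b"
  by (auto simp: unit_step_def)

lemma floor_step_nonzero: "a \<noteq> 0 \<or> b \<noteq> 0 \<Longrightarrow> floor_step a b = unit_step a b"
  by (auto simp: floor_step_def)

lemma floor_stepI: "unit_step a b \<Longrightarrow> floor_step a b"
  by (simp add: floor_step_def)

lemma successively_floor_step:
  "0 \<notin> set h \<Longrightarrow> successively floor_step h \<longleftrightarrow> successively unit_step h"
  by (intro successively_cong HOL.refl floor_step_nonzero) auto

text \<open>Heights change by at most 1 per step. This Lipschitz bound yields both the finiteness of
  walks meeting the axis and the bound on their area.\<close>

lemma successively_bound:
  "successively floor_step h \<Longrightarrow> i \<le> j \<Longrightarrow> j < length h \<Longrightarrow> h ! j \<le> h ! i + (j - i) \<and> h ! i \<le> h ! j + (j - i)"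
proof (induction j)
  case (Suc j)
  show ?case
  proof (cases "i = Suc j")
    case False
    have "floor_step (h ! j) (h ! Suc j)"
      using Suc.prems by (simp add: successively_conv_nth)
    then show ?thesis using False Suc by (auto simp: floor_step_def unit_step_def)
  qed simp
qed simp

lemma walks_eq: "walks m = {h. length h = m + 1 \<and> successively unit_step h}"
  by (auto simp: walks_def successively_conv_nth unit_step_def)

lemma sum_nth_eq_sum_list: "length h = m + 1 \<Longrightarrow> (\<Sum>i=0..m. h ! i) = sum_list h"
  by (simp add: sum_list_sum_nth atLeastLessThanSuc_atLeastAtMost)

lemma sum_nth_eq_sum_list_tl:
  assumes "length h = m + 1"
  shows "(\<Sum>i=1..m. h ! i) = sum_list (tl h)"
proof -
  from assms obtain a g where h: "h = a # g" "length g = m" by (cases h) auto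
  have "(\<Sum>i=1..m. h ! i) = (\<Sum>i=0..<m. h ! Suc i)"
    by (simp add: sum.shift_bounds_Suc_ivl[symmetric] atLeastLessThanSuc_atLeastAtMost)
  with h show ?thesis by (simp add: sum_list_sum_nth)
qed

lemma hd_last_nth:
  assumes "length h = m + 1"
  shows "hd h = h ! 0" "last h = h ! m"
proof -
  have "h \<noteq> []" using assms by auto
  then show "hd h = h ! 0" "last h = h ! m" using assms by (simp_all add: hd_conv_nth last_conv_nth)
qed

definition dyck :: "nat \<Rightarrow> nat list set" where
  "dyck m = {h. length h = m + 1 \<and> successively unit_step h \<and> hd h = 0 \<and> last h = 0}"

definition floor_walks :: "nat \<Rightarrow> nat list set" where
  "floor_walks m = {h. length h = m + 1 \<and> successively floor_step h \<and> hd h = 0 \<and> last h = 0}"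

text \<open>The height at position 0 is repeated at the end, as in \<open>O_walks\<close>; the
  weight \<open>sum_list (tl h)\<close> therefore counts every position of the cycle once.\<close>

definition cyc :: "nat \<Rightarrow> nat list set" where
  "cyc n = {h. length h = n + 1 \<and> successively floor_step h \<and> hd h = last h}"

lemma dyck_paths_eq: "dyck_paths m = dyck m"
  by (auto simp: dyck_paths_def walks_eq dyck_def hd_last_nth)

lemma O_walks_eq: "O_walks m = {h. length h = m + 1 \<and> successively unit_step h \<and> hd h = last h}"
  by (auto simp: O_walks_def walks_eq hd_last_nth)

lemma dyck_subset_floor_walks: "dyck m \<subseteq> floor_walks m"
  by (auto simp: dyck_def floor_walks_def intro: successively_mono floor_stepI)

lemma finite_bounded_lists: "finite {h :: nat list. length h = m \<and> set h \<subseteq> {..k}}"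
  by (rule finite_subset[OF _ finite_lists_length_eq[of "{..k}" m]]) auto

lemma finite_zero_hitting_cyc: "finite {h \<in> cyc n. 0 \<in> set h}"
proof (rule finite_subset[OF _ finite_bounded_lists])
  show "{h \<in> cyc n. 0 \<in> set h} \<subseteq> {h. length h = n + 1 \<and> set h \<subseteq> {..n}}"
  proof safe
    fix h x assume h: "h \<in> cyc n" "0 \<in> set h" "x \<in> set h"
    then obtain i j where "i < length h" "h ! i = 0" "j < length h" "h ! j = x"
      by (auto simp: in_set_conv_nth)
    with h show "x \<le> n"
      using successively_bound[of h i j] successively_bound[of h j i]
      by (cases "i \<le> j") (auto simp: cyc_def)
  qed (simp add: cyc_def)
qed

lemma finite_floor_walks: "finite (floor_walks m)"
proof (rule finite_subset[OF _ finite_zero_hitting_cyc[of m]])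
  show "floor_walks m \<subseteq> {h \<in> cyc m. 0 \<in> set h}"
    by (auto simp: floor_walks_def cyc_def) (metis Zero_not_Suc hd_in_set list.size(3))
qed

lemma finite_dyck: "finite (dyck m)"
  using dyck_subset_floor_walks finite_floor_walks by (rule finite_subset)

text \<open>The entry dropped by \<open>tl\<close> reappears as the last one, so every height occurs
  in the tail.\<close>

lemma cyc_entry_le:
  assumes "h \<in> cyc n" "n > 0" "x \<in> set h"
  shows "x \<le> sum_list (tl h)"
proof -
  from assms obtain a g where h: "h = a # g" "g \<noteq> []" by (cases h) (auto simp: cyc_def)
  with assms have "x \<in> set g" by (auto simp: cyc_def)
  then show ?thesis using h by (simp add: member_le_sum_list)
qed

lemma finite_cyc_fibre:
  assumes "n > 0"
  shows "finite {h \<in> cyc n. sum_list (tl h) = k}"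
  by (rule finite_subset[OF _ finite_bounded_lists[of "n + 1" k]])
     (use cyc_entry_le[OF _ assms] in \<open>auto simp: cyc_def\<close>)

lemma dyck_M_nth: "fps_nth dyck_M m = gen_fun (dyck m) sum_list"
  unfolding dyck_M_def
  by (simp only: fps_nth_Abs_fps) (rule gen_fun_cong, auto simp: dyck_paths_eq dyck_def sum_nth_eq_sum_list)

section \<open>Splitting at horizontal steps\<close>

definition floor_K :: "rat fps fps" where
  "floor_K = Abs_fps (\<lambda>m. gen_fun (floor_walks m) sum_list)"

text \<open>As \<open>d\<close> makes only unit steps, it ends where the first horizontal step
  begins; that step is the junction of \<open>d\<close> and \<open>k\<close> and lies in
  neither.\<close>

lemma floor_step_first_flat:
  assumes "successively floor_step h" "\<not> successively unit_step h"
  shows "\<exists>d k. h = d @ k \<and> d \<noteq> [] \<and> k \<noteq> [] \<and> successively unit_step d \<and> last d = 0 \<and>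
    hd k = 0 \<and> successively floor_step k"
  using assms
proof (induction h)
  case (Cons a h)
  then obtain b g where h: "h = b # g" by (cases h) auto
  show ?case
  proof (cases "unit_step a b")
    case False
    with Cons.prems h show ?thesis
      by (intro exI[of _ "[a]"] exI[of _ h]) (auto simp: floor_step_def)
  next
    case True
    with Cons h obtain d k where *: "h = d @ k" "d \<noteq> []" "k \<noteq> []" "successively unit_step d"
      "last d = 0" "hd k = 0" "successively floor_step k" by auto
    with h have "hd d = b" by (cases d) auto
    with * True show ?thesis
      by (intro exI[of _ "a # d"] exI[of _ k]) (simp add: successively_Cons)
  qed
qed simp

lemma floor_walks_Suc:
  "bij_betw (\<lambda>(i, d, k). d @ k) (SIGMA i:{..m}. dyck i \<times> floor_walks (m - i))
     (floor_walks (Suc m) - dyck (Suc m))"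
  (is "bij_betw ?f ?A ?B")
proof (rule bij_betw_imageI)
  \<comment> \<open>If \<open>d'\<close> were longer than \<open>d\<close>, the horizontal step at
    the end of \<open>d\<close> would lie inside the Dyck path \<open>d'\<close>.\<close>
  have le: "length d' \<le> length d"
    if "d @ k = d' @ k'" "d \<in> dyck i" "k \<in> floor_walks j" "d' \<in> dyck i'" for d d' k k' i j i'
  proof (rule ccontr)
    assume "\<not> ?thesis"
    with that(1) obtain e where e: "d' = d @ e" "k = e @ k'" "e \<noteq> []"
      by (auto simp: append_eq_append_conv2)
    with that have "last d = 0" "hd e = 0" "d \<noteq> []"
      by (auto simp: dyck_def floor_walks_def)
    moreover have "successively unit_step (d @ e)" using that(4) e by (simp add: dyck_def)
    ultimately show False using e by (simp add: successively_append_iff)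
  qed
  show "inj_on ?f ?A"
  proof (rule inj_onI)
    fix x y assume xy: "x \<in> ?A" "y \<in> ?A" "?f x = ?f y"
    obtain i d k i' d' k' where [simp]: "x = (i, d, k)" "y = (i', d', k')"
      by (metis prod_cases3)
    have "length d = length d'"
      using le[of d k d' k' i "m - i" i'] le[of d' k' d k i' "m - i'" i] xy by auto
    with xy show "x = y" by (auto simp: dyck_def)
  qed
  show "?f ` ?A = ?B"
  proof safe
    fix i d k assume *: "i \<le> m" "d \<in> dyck i" "k \<in> floor_walks (m - i)"
    have ne: "d \<noteq> []" "k \<noteq> []" using * by (auto simp: dyck_def floor_walks_def)
    have "d \<in> floor_walks i" using * dyck_subset_floor_walks by blast
    with * ne show "d @ k \<in> floor_walks (Suc m)"
      by (auto simp: floor_walks_def successively_append_iff floor_step_def)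
    assume "d @ k \<in> dyck (Suc m)"
    with * ne show False
      by (auto simp: dyck_def floor_walks_def successively_append_iff)
  next
    fix h assume h: "h \<in> floor_walks (Suc m)" "h \<notin> dyck (Suc m)"
    then obtain d k where *: "h = d @ k" "d \<noteq> []" "k \<noteq> []" "successively unit_step d" "last d = 0"
      "hd k = 0" "successively floor_step k"
      using floor_step_first_flat[of h] by (auto simp: floor_walks_def dyck_def)
    define i where "i = length d - 1"
    have "length d > 0" "length k > 0" "length d + length k = Suc (Suc m)"
      using * h by (simp_all add: floor_walks_def)
    then have len: "length d = i + 1" "length k = Suc m - i" "i \<le> m"
      unfolding i_def by linarith+
    then have "(i, d, k) \<in> ?A"
      using * h by (auto simp: dyck_def floor_walks_def)
    with *(1) show "h \<in> ?f ` ?A" by force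
  qed
qed

lemma sum_Sigma_mult:
  fixes f :: "'a \<Rightarrow> 'b \<Rightarrow> rat fps"
  assumes "finite A" "\<And>i. finite (B i)" "\<And>i. finite (C i)"
  shows "(\<Sum>(i, d, k)\<in>(SIGMA i:A. B i \<times> C i). f i d * g i k) =
    (\<Sum>i\<in>A. (\<Sum>d\<in>B i. f i d) * (\<Sum>k\<in>C i. g i k))"
proof -
  have "(\<Sum>(i, d, k)\<in>(SIGMA i:A. B i \<times> C i). f i d * g i k) =
      (\<Sum>i\<in>A. \<Sum>(d, k)\<in>B i \<times> C i. f i d * g i k)"
    using assms by (subst sum.Sigma) (auto intro!: sum.cong)
  also have "\<dots> = (\<Sum>i\<in>A. (\<Sum>d\<in>B i. f i d) * (\<Sum>k\<in>C i. g i k))"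
    by (intro sum.cong) (auto simp: sum_product sum.cartesian_product)
  finally show ?thesis .
qed

text \<open>A floor walk either is a Dyck path or splits at its first horizontal step.\<close>

lemma floor_K_eq: "floor_K = dyck_M + fps_X * dyck_M * floor_K"
proof (rule fps_ext)
  fix m
  show "fps_nth floor_K m = fps_nth (dyck_M + fps_X * dyck_M * floor_K) m"
  proof (cases m)
    case 0
    have "floor_walks 0 = {[0]}" "dyck 0 = {[0]}"
      by (auto simp: floor_walks_def dyck_def length_Suc_conv)
    with 0 show ?thesis by (simp add: floor_K_def dyck_M_nth mult.assoc)
  next
    case (Suc l)
    let ?A = "SIGMA i:{..l}. dyck i \<times> floor_walks (l - i)"
    have "gen_fun (floor_walks m) sum_list =
        gen_fun (dyck m \<union> (floor_walks m - dyck m)) sum_list"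
      by (intro gen_fun_cong) (use dyck_subset_floor_walks in auto)
    also have "\<dots> = gen_fun (dyck m) sum_list + gen_fun (floor_walks m - dyck m) sum_list"
      by (rule gen_fun_Un) (auto intro: finite_subset[OF _ finite_Un[THEN iffD2, OF conjI[OF
        finite_dyck finite_floor_walks]]])
    also have "gen_fun (floor_walks m - dyck m) sum_list =
        gen_fun ?A (\<lambda>(i, d, k). sum_list d + sum_list k)"
      unfolding Suc by (rule gen_fun_bij_betw[OF floor_walks_Suc, symmetric]) auto
    also have "\<dots> = (\<Sum>(i, d, k)\<in>?A. fps_X ^ sum_list d * fps_X ^ sum_list k)"
      by (subst gen_fun_finite)
         (auto intro!: finite_dyck finite_floor_walks sum.cong simp: power_add)
    also have "\<dots> = (\<Sum>i\<le>l. gen_fun (dyck i) sum_list * gen_fun (floor_walks (l - i)) sum_list)"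
      by (subst sum_Sigma_mult) (auto simp: finite_dyck finite_floor_walks gen_fun_finite)
    \<comment> \<open>The factor \<open>fps_X\<close> accounts for the horizontal step joining the
      two pieces.\<close>
    also have "\<dots> = fps_nth (fps_X * (dyck_M * floor_K)) m"
      unfolding Suc fps_X_mult_nth
      by (simp add: fps_mult_nth floor_K_def dyck_M_nth atLeast0AtMost)
    finally show ?thesis
      by (simp add: floor_K_def dyck_M_nth mult.assoc)
  qed
qed

section \<open>The excursion around position 0\<close>

lemma successively_unit_step_map_Suc: "successively unit_step (map Suc p) \<longleftrightarrow> successively unit_step p"
  by (simp add: successively_map)

text \<open>
  A cyclic walk meeting the axis away from position \<open>0\<close>: the excursion around position \<open>0\<close> is a
  raised Dyck path \<open>p\<close>, cut at its point \<open>q\<close>, and \<open>k\<close> is the rest of the walk.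
\<close>

definition wrap :: "nat \<Rightarrow> nat list \<Rightarrow> nat list \<Rightarrow> nat list" where
  "wrap q p k = drop q (map Suc p) @ k @ take (q + 1) (map Suc p)"

lemma map_Suc_pred: "0 \<notin> set h \<Longrightarrow> map Suc (map (\<lambda>x. x - 1) h) = h"
  by (induction h) auto

lemma sum_list_map_Suc: "sum_list (map Suc p) = sum_list p + length p"
  by (induction p) auto

text \<open>Two unit steps between heights 1 and 0 join \<open>k\<close> to the excursion, hence
  \<open>j + m + 2\<close> steps. Point \<open>q\<close> appears at both ends and \<open>tl\<close>
  removes one copy, so each of the \<open>m + 1\<close> points of \<open>p\<close> contributes once,
  raised by 1.\<close>

lemma wrap_in_cyc:
  assumes "p \<in> dyck m" "q \<le> m" "k \<in> floor_walks j"
  shows "wrap q p k \<in> cyc (j + m + 2)" "hd (wrap q p k) \<noteq> 0" "0 \<in> set (wrap q p k)"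
    "sum_list (tl (wrap q p k)) = sum_list p + (m + 1) + sum_list k"
proof -
  define e where "e = map Suc p"
  have p: "length p = m + 1" "successively unit_step p" "hd p = 0" "last p = 0"
    using assms(1) by (auto simp: dyck_def)
  then have e: "length e = m + 1" "successively unit_step e" "hd e = 1" "last e = 1" "e \<noteq> []"
    "sum_list e = sum_list p + (m + 1)" "0 \<notin> set e"
    by (auto simp: e_def successively_unit_step_map_Suc hd_map last_map sum_list_map_Suc
        simp flip: length_greater_0_conv)
  define A where "A = drop q e"
  define B where "B = take (q + 1) e"
  have w: "wrap q p k = A @ k @ B" by (simp add: wrap_def A_def B_def e_def)
  have k: "length k = j + 1" "successively floor_step k" "hd k = 0" "last k = 0" "k \<noteq> []"
    using assms(3) by (auto simp: floor_walks_def)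
  have A: "length A = m + 1 - q" "A \<noteq> []" "hd A = e ! q" "last A = 1"
    using e assms(2) by (auto simp: A_def hd_drop_conv_nth)
  have B: "length B = q + 1" "B \<noteq> []" "hd B = 1" "last B = e ! q"
    using e assms(2) by (auto simp: B_def last_conv_nth min_def)
  have "take q e @ A = e" "B = take q e @ [e ! q]"
    using e assms(2) by (auto simp: A_def B_def take_Suc_conv_app_nth)
  then have sB: "sum_list B = sum_list (take q e) + e ! q"
    and sA: "sum_list e = sum_list (take q e) + sum_list A"
    by (simp, metis sum_list_append)
  have succ: "successively unit_step A" "successively unit_step B"
    using e(2) by (metis A_def append_take_drop_id successively_append_iff)
      (metis B_def e(2) append_take_drop_id successively_append_iff)
  then have "successively floor_step A" "successively floor_step B"
    by (auto intro: successively_mono floor_stepI)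
  then have "successively floor_step (A @ k @ B)"
    using A B k by (simp add: successively_append_iff floor_step_def)
  moreover have "hd (A @ k @ B) = last (A @ k @ B)" using A B by simp
  moreover have "length (A @ k @ B) = j + m + 2 + 1" using A B k assms(2) by simp
  ultimately show "wrap q p k \<in> cyc (j + m + 2)" by (simp add: w cyc_def)
  have "e ! q \<in> set e" using e assms(2) by simp
  with e(7) have "e ! q \<noteq> 0" by metis
  then show "hd (wrap q p k) \<noteq> 0" using A by (simp add: w)
  show "0 \<in> set (wrap q p k)" using k hd_in_set[of k] by (simp add: w)
  have "sum_list A = e ! q + sum_list (tl A)" using A by (cases A) auto
  then show "sum_list (tl (wrap q p k)) = sum_list p + (m + 1) + sum_list k"
    using A sA sB e(6) by (simp add: w)
qed

lemma wrap_inj: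
  assumes "p \<in> dyck m" "q \<le> m" "k \<in> floor_walks j" "p' \<in> dyck m'" "q' \<le> m'" "k' \<in> floor_walks j'"
    and eq: "wrap q p k = wrap q' p' k'"
  shows "q = q' \<and> p = p' \<and> k = k'"
proof -
  \<comment> \<open>The two parts of the raised path are the longest prefix and suffix without
    zeros, since they contain none and \<open>k\<close> begins and ends with 0.\<close>
  have split: "drop q (map Suc p) = takeWhile (\<lambda>x. x \<noteq> 0) (wrap q p k)"
      "rev (take (q + 1) (map Suc p)) = takeWhile (\<lambda>x. x \<noteq> 0) (rev (wrap q p k))"
      "length (take (q + 1) (map Suc p)) = q + 1"
    if "p \<in> dyck m" "q \<le> m" "k \<in> floor_walks j" for p q k m j
  proof -
    from that have k: "k \<noteq> []" "hd k = 0" "last k = 0" by (auto simp: floor_walks_def)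
    then obtain k1 k2 where k12: "k = 0 # k1" "k = k2 @ [0]"
      by (metis append_butlast_last_id list.exhaust_sel)
    have "takeWhile (\<lambda>x. x \<noteq> 0) (drop q (map Suc p) @ 0 # r) = drop q (map Suc p)" for r
      by (subst takeWhile_append2) (auto dest: in_set_dropD)
    then show "drop q (map Suc p) = takeWhile (\<lambda>x. x \<noteq> 0) (wrap q p k)"
      by (simp add: wrap_def k12(1))
    have "takeWhile (\<lambda>x. x \<noteq> 0) (rev (take (q + 1) (map Suc p)) @ 0 # r) = rev (take (q + 1) (map Suc p))" for r
      by (subst takeWhile_append2) (auto dest: in_set_takeD)
    then show "rev (take (q + 1) (map Suc p)) = takeWhile (\<lambda>x. x \<noteq> 0) (rev (wrap q p k))"
      by (simp add: wrap_def k12(2))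
    show "length (take (q + 1) (map Suc p)) = q + 1" using that by (simp add: dyck_def)
  qed
  have 1: "drop q (map Suc p) = drop q' (map Suc p')"
    using split(1)[OF assms(1-3)] split(1)[OF assms(4-6)] eq by simp
  have 2: "take (q + 1) (map Suc p) = take (q' + 1) (map Suc p')"
    using split(2)[OF assms(1-3)] split(2)[OF assms(4-6)] eq by (metis rev_rev_ident)
  then have q: "q = q'"
    using split(3)[OF assms(1-3)] split(3)[OF assms(4-6)] by (metis add_right_cancel)
  from 2 have "take q (map Suc p) = take q (map Suc p')"
    unfolding q by (metis le_add1 min.absorb1 take_take)
  with 1 have "map Suc p = map Suc p'" unfolding q by (metis append_take_drop_id)
  then have "p = p'" by (simp add: inj_map_eq_map)
  moreover have "k = k'" using eq 1 2 by (simp add: wrap_def q)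
  ultimately show ?thesis using q by simp
qed

text \<open>The walk is cut at its first and its last zero. The outer pieces avoid the axis, so they
  have unit steps only and fit together at the common end point of the cycle.\<close>

lemma wrap_surj:
  assumes "h \<in> cyc n" "hd h \<noteq> 0" "0 \<in> set h"
  shows "\<exists>m j q p k. n = j + m + 2 \<and> p \<in> dyck m \<and> q \<le> m \<and> k \<in> floor_walks j \<and> h = wrap q p k"
proof -
  from assms(3) obtain A r where A: "h = A @ 0 # r" "0 \<notin> set A" by (meson split_list_first)
  obtain r' B where B: "0 # r = r' @ 0 # B" "0 \<notin> set B"
    by (meson split_list_last list.set_intros(1))
  define k where "k = r' @ [0]"
  have h: "h = A @ k @ B" using A(1) B(1) by (simp add: k_def)
  have k: "hd k = 0" "last k = 0" "k \<noteq> []" using B(1) by (cases r'; auto simp: k_def)+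
  have sh: "successively floor_step h" "hd h = last h" "length h = n + 1"
    using assms(1) by (auto simp: cyc_def)
  have ne: "A \<noteq> []" "B \<noteq> []" using assms(2) sh(2) k h by (auto simp: hd_append)
  have s: "successively floor_step A" "successively floor_step k" "successively floor_step B"
    "floor_step (last A) 0" "floor_step 0 (hd B)"
    using sh(1) ne k by (auto simp: h successively_append_iff)
  have "last A \<noteq> 0" "hd B \<noteq> 0" using ne A(2) B(2) by (metis last_in_set, metis hd_in_set)
  with s have ends: "last A = 1" "hd B = 1" by (auto simp: floor_step_def)
  have su: "successively unit_step A" "successively unit_step B"
    using s A(2) B(2) by (simp_all add: successively_floor_step)
  have meet: "hd A = last B" using sh(2) ne by (simp add: h)
  define q where "q = length B - 1"
  \<comment> \<open>The last point of \<open>B\<close> and the first of \<open>A\<close> are the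
    same point of the cycle; one copy is dropped when the excursion is glued together.\<close>
  define e where "e = butlast B @ A"
  define p where "p = map (\<lambda>x. x - 1) e"
  define m where "m = length e - 1"
  define j where "j = length k - 1"
  have Bsnoc: "B = butlast B @ [hd A]" using ne meet by simp
  have e0: "0 \<notin> set e" using A(2) B(2) by (auto simp: e_def dest: in_set_butlastD)
  then have ep: "map Suc p = e" unfolding p_def by (rule map_Suc_pred)
  have su_e: "successively unit_step e"
    using su ne Bsnoc unfolding e_def by (metis list.sel(1) not_Cons_self2 successively_append_iff)
  have "hd e = 1" using ends(2) Bsnoc ne meet
    by (cases B) (auto simp: e_def hd_append)
  moreover have "last e = 1" using ends ne by (simp add: e_def)
  moreover have "p \<noteq> []" using ne by (simp add: p_def e_def)
  ultimately have "hd p = 0" "last p = 0" by (simp_all add: p_def hd_map last_map)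
  then have "p \<in> dyck m"
    using su_e \<open>p \<noteq> []\<close> unfolding ep[symmetric]
    by (simp add: dyck_def successively_unit_step_map_Suc m_def ep[symmetric])
  moreover have "q \<le> m" using ne by (cases A) (auto simp: q_def m_def e_def)
  moreover have "k \<in> floor_walks j" using k s by (simp add: floor_walks_def j_def)
  moreover have "h = wrap q p k"
  proof -
    have "drop q e = A" by (simp add: e_def q_def)
    moreover have "q = length (butlast B)" by (simp add: q_def)
    with ne have "take (q + 1) e = butlast B @ [hd A]"
      by (cases A) (simp_all add: e_def del: length_butlast)
    then have "take (q + 1) e = B" by (simp only: Bsnoc[symmetric])
    ultimately show ?thesis by (simp add: wrap_def ep h)
  qed
  moreover have "n = j + m + 2"
  proof -
    have "length A > 0" "length B > 0" "length k > 0" using ne k by simp_all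
    moreover have "length A + length k + length B = n + 1" using sh(3) by (simp add: h)
    moreover have "length e = length B - 1 + length A" by (simp add: e_def)
    ultimately show ?thesis unfolding j_def m_def by linarith
  qed
  ultimately show ?thesis by blast
qed

definition wrap_index :: "nat \<Rightarrow> (nat \<times> (nat \<times> nat list) \<times> nat list) set" where
  "wrap_index n = (SIGMA m:{..n - 2}. ({..m} \<times> dyck m) \<times> floor_walks (n - 2 - m))"

lemma bij_betw_wrap:
  assumes "n \<ge> 2"
  shows "bij_betw (\<lambda>(m, (q, p), k). wrap q p k) (wrap_index n) {h \<in> cyc n. hd h \<noteq> 0 \<and> 0 \<in> set h}"
proof (rule bij_betw_imageI)
  show "inj_on (\<lambda>(m, (q, p), k). wrap q p k) (wrap_index n)"
  proof (rule inj_onI)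
    fix x y assume xy: "x \<in> wrap_index n" "y \<in> wrap_index n"
      "(\<lambda>(m, (q, p), k). wrap q p k) x = (\<lambda>(m, (q, p), k). wrap q p k) y"
    obtain m q p k where x [simp]: "x = (m, (q, p), k)" by (metis prod.collapse)
    obtain m' q' p' k' where y [simp]: "y = (m', (q', p'), k')" by (metis prod.collapse)
    have "q = q' \<and> p = p' \<and> k = k'"
      by (rule wrap_inj[of p m q k "n - 2 - m" p' m' q' k' "n - 2 - m'"])
        (use xy in \<open>auto simp: wrap_index_def\<close>)
    with xy show "x = y" by (auto simp: wrap_index_def dyck_def)
  qed
  show "(\<lambda>(m, (q, p), k). wrap q p k) ` wrap_index n = {h \<in> cyc n. hd h \<noteq> 0 \<and> 0 \<in> set h}"
  proof (intro equalityI subsetI)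
    fix h assume "h \<in> (\<lambda>(m, (q, p), k). wrap q p k) ` wrap_index n"
    then obtain m q p k where *: "m \<le> n - 2" "q \<le> m" "p \<in> dyck m" "k \<in> floor_walks (n - 2 - m)"
      "h = wrap q p k" by (auto simp: wrap_index_def)
    have n: "n - 2 - m + m + 2 = n" using * assms by simp
    show "h \<in> {h \<in> cyc n. hd h \<noteq> 0 \<and> 0 \<in> set h}"
      using wrap_in_cyc(1-3)[OF *(3,2,4)] unfolding n *(5) by blast
  next
    fix h assume "h \<in> {h \<in> cyc n. hd h \<noteq> 0 \<and> 0 \<in> set h}"
    then obtain m j q p k where *: "n = j + m + 2" "p \<in> dyck m" "q \<le> m" "k \<in> floor_walks j"
      "h = wrap q p k" using wrap_surj[of h n] by blast
    then have "(m, (q, p), k) \<in> wrap_index n" by (simp add: wrap_index_def)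
    then show "h \<in> (\<lambda>(m, (q, p), k). wrap q p k) ` wrap_index n"
      unfolding *(5) by force
  qed
qed

text \<open>The series of raised excursions with a marked point. A Dyck path of length m contributes
  at \<open>x^(m+2)\<close> because of its two connecting steps; substituting \<open>tx\<close>
  gives \<open>t^m\<close> and the outer factor one more \<open>t\<close>, for the raise of
  \<open>m + 1\<close> points; the derivative gives the \<open>m + 1\<close> choices of the point at
  position 0.\<close>

definition raised_M :: "rat fps fps" where
  "raised_M = fps_const fps_X * fps_X\<^sup>2 *
     fps_compose (fps_deriv (fps_X * dyck_M)) (fps_const fps_X * fps_X)"

lemma raised_M_nth:
  "fps_nth raised_M n = (if n < 2 then 0 else
     of_nat (n - 1) * fps_X ^ (n - 1) * gen_fun (dyck (n - 2)) sum_list)"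
proof (cases "n < 2")
  case True
  then show ?thesis
    unfolding raised_M_def mult.assoc fps_mult_left_const_nth fps_X_power_mult_nth by simp
next
  case False
  then obtain m where n: "n = m + 2" by (metis le_add_diff_inverse2 not_less)
  have "fps_nth raised_M (m + 2) = fps_X * (fps_X ^ m * fps_nth (fps_deriv (fps_X * dyck_M)) m)"
    unfolding raised_M_def mult.assoc fps_mult_left_const_nth fps_X_power_mult_nth
      fps_nth_compose_linear by simp
  also have "fps_nth (fps_deriv (fps_X * dyck_M)) m = of_nat (m + 1) * gen_fun (dyck m) sum_list"
    by (simp only: fps_deriv_nth fps_X_mult_nth dyck_M_nth) simp
  finally show ?thesis by (simp add: n mult_ac)
qed

lemma gen_fun_wrapped:
  assumes "n \<ge> 2"
  shows "gen_fun {h \<in> cyc n. hd h \<noteq> 0 \<and> 0 \<in> set h} (\<lambda>h. sum_list (tl h)) =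
    fps_nth (raised_M * floor_K) n"
proof -
  have "gen_fun {h \<in> cyc n. hd h \<noteq> 0 \<and> 0 \<in> set h} (\<lambda>h. sum_list (tl h)) =
      gen_fun (wrap_index n) (\<lambda>(m, (q, p), k). sum_list p + (m + 1) + sum_list k)"
    by (rule gen_fun_bij_betw[OF bij_betw_wrap[OF assms], symmetric])
       (auto simp: wrap_index_def wrap_in_cyc)
  also have "\<dots> = (\<Sum>(m, (q, p), k)\<in>wrap_index n. fps_X ^ (sum_list p + (m + 1)) * fps_X ^ sum_list k)"
    by (subst gen_fun_finite)
       (auto intro!: finite_dyck finite_floor_walks sum.cong simp: power_add wrap_index_def)
  also have "\<dots> = (\<Sum>m\<le>n - 2. (\<Sum>(q, p)\<in>{..m} \<times> dyck m. fps_X ^ (sum_list p + (m + 1))) *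
      gen_fun (floor_walks (n - 2 - m)) sum_list)"
    using sum_Sigma_mult[of "{..n - 2}" "\<lambda>m. {..m} \<times> dyck m" "\<lambda>m. floor_walks (n - 2 - m)"
        "\<lambda>m (q, p). fps_X ^ (sum_list p + (m + 1))" "\<lambda>m k. fps_X ^ sum_list k"]
    unfolding wrap_index_def
    by (simp add: finite_dyck finite_floor_walks gen_fun_finite case_prod_unfold)
  also have "\<dots> = (\<Sum>m\<le>n - 2. fps_nth raised_M (m + 2) * fps_nth floor_K (n - (m + 2)))"
  proof (intro sum.cong HOL.refl arg_cong2[of _ _ _ _ "(*)"])
    fix m
    have "(\<Sum>(q, p)\<in>{..m} \<times> dyck m. fps_X ^ (sum_list p + (m + 1))) =
        (\<Sum>q\<le>m. \<Sum>p\<in>dyck m. fps_X ^ (sum_list p + (m + 1)) :: rat fps)"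
      by (rule sum.cartesian_product[symmetric])
    also have "\<dots> = of_nat (m + 1) * fps_X ^ (m + 1) * gen_fun (dyck m) sum_list"
      by (simp add: gen_fun_finite finite_dyck sum_distrib_left power_add mult_ac)
    finally show "(\<Sum>(q, p)\<in>{..m} \<times> dyck m. fps_X ^ (sum_list p + (m + 1))) = fps_nth raised_M (m + 2)"
      by (simp add: raised_M_nth)
    show "gen_fun (floor_walks (n - 2 - m)) sum_list = fps_nth floor_K (n - (m + 2))"
      by (simp add: floor_K_def add.commute)
  qed
  also have "\<dots> = (\<Sum>i=2..n. fps_nth raised_M i * fps_nth floor_K (n - i))"
    by (rule sum.reindex_bij_witness[of _ "\<lambda>i. i - 2" "\<lambda>m. m + 2"]) (use assms in auto)
  also have "\<dots> = (\<Sum>i=0..n. fps_nth raised_M i * fps_nth floor_K (n - i))"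
    by (rule sum.mono_neutral_left) (auto simp: raised_M_nth)
  finally show ?thesis by (simp add: fps_mult_nth)
qed

lemma floor_K_quotient:
  "dyck_M * (1 + raised_M) / (1 - fps_X * dyck_M) = floor_K * (1 + raised_M)"
proof -
  have K: "floor_K * (1 - fps_X * dyck_M) = dyck_M"
    using floor_K_eq by (simp add: algebra_simps)
  have "fps_nth (1 - fps_X * dyck_M) 0 = 1" by simp
  then have ne: "1 - fps_X * dyck_M \<noteq> 0" by (metis fps_zero_nth zero_neq_one)
  have "dyck_M * (1 + raised_M) / (1 - fps_X * dyck_M) * (1 - fps_X * dyck_M) =
      floor_K * (1 + raised_M) * (1 - fps_X * dyck_M)"
    unfolding divide_one_minus_x_dyck_M by (subst K[symmetric]) (simp only: mult_ac)
  with ne show ?thesis by (metis mult_right_cancel)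
qed

text \<open>Walks with height 0 at position 0 are floor walks, counted by \<open>floor_K\<close>;
  the others that meet the axis are counted by \<open>raised_M * floor_K\<close>.\<close>

lemma gen_fun_zero_hitting:
  assumes "n \<ge> 2"
  shows "gen_fun {h \<in> cyc n. 0 \<in> set h} (\<lambda>h. sum_list (tl h)) =
    fps_nth (dyck_M * (1 + raised_M) / (1 - fps_X * dyck_M)) n"
proof -
  let ?w = "\<lambda>h :: nat list. sum_list (tl h)"
  have hd0: "h \<noteq> []" "0 \<in> set h" "sum_list (tl h) = sum_list h" if "h \<in> floor_walks n" for h
    using that by (cases h; auto simp: floor_walks_def)+
  have "gen_fun {h \<in> cyc n. 0 \<in> set h} ?w =
      gen_fun (floor_walks n \<union> {h \<in> cyc n. hd h \<noteq> 0 \<and> 0 \<in> set h}) ?w"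
    by (intro gen_fun_cong) (use hd0 in \<open>auto simp: floor_walks_def cyc_def\<close>)
  also have "\<dots> = gen_fun (floor_walks n) ?w + gen_fun {h \<in> cyc n. hd h \<noteq> 0 \<and> 0 \<in> set h} ?w"
  proof (rule gen_fun_Un)
    show "finite {x \<in> floor_walks n \<union> {h \<in> cyc n. hd h \<noteq> 0 \<and> 0 \<in> set h}. ?w x = k}" for k
      by (rule finite_subset[of _ "floor_walks n \<union> {h \<in> cyc n. 0 \<in> set h}"])
         (auto simp: finite_floor_walks finite_zero_hitting_cyc)
  qed (auto simp: floor_walks_def)
  also have "gen_fun (floor_walks n) ?w = fps_nth floor_K n"
    unfolding floor_K_def by (simp only: fps_nth_Abs_fps) (rule gen_fun_cong[OF HOL.refl hd0(3)])
  also note gen_fun_wrapped[OF assms]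
  finally show ?thesis
    unfolding floor_K_quotient by (simp add: algebra_simps)
qed

section \<open>Walks avoiding the axis\<close>

lemma positive_cyc_eq: "{h \<in> cyc n. 0 \<notin> set h} = {h \<in> O_walks n. 0 \<notin> set h}"
  by (auto simp: cyc_def O_walks_eq successively_floor_step)

lemma O_walks_subset_cyc: "O_walks n \<subseteq> cyc n"
  by (auto simp: cyc_def O_walks_eq intro: successively_mono floor_stepI)

lemma bij_betw_raise: "bij_betw (map Suc) (O_walks n) {h \<in> O_walks n. 0 \<notin> set h}"
proof (rule bij_betw_byWitness[where f' = "map (\<lambda>x. x - 1)"])
  show "\<forall>h\<in>{h \<in> O_walks n. 0 \<notin> set h}. map Suc (map (\<lambda>x. x - 1) h) = h"
    using map_Suc_pred by blast
  show "\<forall>h\<in>O_walks n. map (\<lambda>x. x - 1) (map Suc h) = h"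
    by (simp add: o_def)
  show "map Suc ` O_walks n \<subseteq> {h \<in> O_walks n. 0 \<notin> set h}"
    by (auto simp: O_walks_eq successively_unit_step_map_Suc hd_map last_map
        simp flip: length_greater_0_conv)
  show "map (\<lambda>x. x - 1) ` {h \<in> O_walks n. 0 \<notin> set h} \<subseteq> O_walks n"
  proof safe
    fix h assume h: "h \<in> O_walks n" "0 \<notin> set h"
    then have "map Suc (map (\<lambda>x. x - 1) h) = h" by (intro map_Suc_pred)
    with h show "map (\<lambda>x. x - 1) h \<in> O_walks n"
      using successively_unit_step_map_Suc[of "map (\<lambda>x. x - 1) h"]
      by (auto simp: O_walks_eq hd_map last_map simp flip: length_greater_0_conv)
  qed
qed

lemma sum_list_tl_raise:
  "h \<in> O_walks n \<Longrightarrow> sum_list (tl (map Suc h)) = sum_list (tl h) + n"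
  by (simp add: O_walks_eq sum_list_map_Suc flip: map_tl)

lemma O_check_eq: "n > 0 \<Longrightarrow> O_check n = gen_fun {h \<in> O_walks n. 0 \<in> set h} (\<lambda>h. sum_list (tl h))"
  unfolding O_check_def
  by (rule gen_fun_cong)
    (auto simp: O_walks_eq in_set_conv_nth sum_nth_eq_sum_list_tl[simplified] less_Suc_eq_le)

text \<open>Raising by one is a bijection from all closed walks onto the positive ones.\<close>

lemma gen_fun_positive:
  assumes "n > 0"
  shows "gen_fun {h \<in> cyc n. 0 \<notin> set h} (\<lambda>h. sum_list (tl h)) = fps_X ^ n * O_check n / (1 - fps_X ^ n)"
proof -
  let ?w = "\<lambda>h :: nat list. sum_list (tl h)"
  let ?P = "gen_fun {h \<in> O_walks n. 0 \<notin> set h} ?w" and ?O = "gen_fun (O_walks n) ?w"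
  have "?P = gen_fun (O_walks n) (\<lambda>h. ?w (map Suc h))"
    by (rule gen_fun_bij_betw[OF bij_betw_raise, symmetric]) simp
  also have "\<dots> = fps_X ^ n * ?O"
    by (rule gen_fun_shift) (simp add: sum_list_tl_raise)
  finally have P: "?P = fps_X ^ n * ?O" .
  have "?O = gen_fun ({h \<in> O_walks n. 0 \<in> set h} \<union> {h \<in> O_walks n. 0 \<notin> set h}) ?w"
    by (rule gen_fun_cong) auto
  also have "\<dots> = O_check n + ?P"
    unfolding O_check_eq[OF assms]
  proof (rule gen_fun_Un)
    show "finite {x \<in> {h \<in> O_walks n. 0 \<in> set h} \<union> {h \<in> O_walks n. 0 \<notin> set h}. ?w x = k}" for k
      using O_walks_subset_cyc by (intro finite_subset[OF _ finite_cyc_fibre[OF assms, of k]]) auto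
  qed auto
  \<comment> \<open>Together with \<open>P\<close> this is a linear system in the series of all
    closed walks and of the positive ones, which is solved for the latter.\<close>
  finally have "?O = O_check n + ?P" .
  with P have "?P * (1 - fps_X ^ n) = fps_X ^ n * O_check n"
    by (simp add: algebra_simps)
  moreover have "fps_nth (1 - fps_X ^ n :: rat fps) 0 = 1" using assms by simp
  then have "(1 - fps_X ^ n :: rat fps) \<noteq> 0" by (metis fps_zero_nth zero_neq_one)
  ultimately show ?thesis
    unfolding positive_cyc_eq by (metis nonzero_mult_div_cancel_right)
qed

lemma gen_fun_cyc:
  assumes "n \<ge> 2"
  shows "gen_fun (cyc n) (\<lambda>h. sum_list (tl h)) = fc_involution_expr n"
proof -
  let ?w = "\<lambda>h :: nat list. sum_list (tl h)"
  have "gen_fun (cyc n) ?w = gen_fun ({h \<in> cyc n. 0 \<notin> set h} \<union> {h \<in> cyc n. 0 \<in> set h}) ?w"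
    by (rule gen_fun_cong) auto
  also have "\<dots> = gen_fun {h \<in> cyc n. 0 \<notin> set h} ?w + gen_fun {h \<in> cyc n. 0 \<in> set h} ?w"
  proof (rule gen_fun_Un)
    show "finite {x \<in> {h \<in> cyc n. 0 \<notin> set h} \<union> {h \<in> cyc n. 0 \<in> set h}. ?w x = k}" for k
      using assms by (intro finite_subset[OF _ finite_cyc_fibre[of n k]]) auto
  qed auto
  also have "\<dots> = fc_involution_expr n"
    using assms by (simp add: gen_fun_positive gen_fun_zero_hitting fc_involution_expr_def
      Let_def raised_M_def)
  finally show ?thesis .
qed

section \<open>Polynomiality and periodicity\<close>

lemma walk_parity:
  "successively unit_step h \<Longrightarrow> h \<noteq> [] \<Longrightarrow> even (hd h + last h + length h + 1)"
proof (induction h)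
  case (Cons a h)
  show ?case
  proof (cases "h = []")
    case False
    with Cons have "even (hd h + last h + length h + 1)" "unit_step a (hd h)"
      by (auto simp: successively_Cons)
    with False show ?thesis by (auto simp: unit_step_def)
  qed simp
qed simp

lemma O_walks_odd_empty: "odd n \<Longrightarrow> O_walks n = {}"
  using walk_parity by (fastforce simp: O_walks_eq)

text \<open>Unit steps change the parity of the height, so a closed walk of odd length needs a
  horizontal step and therefore meets the axis. Only finitely many walks do.\<close>

lemma fc_involution_expr_polynomial:
  assumes "odd n" "n \<ge> 2"
  shows "\<exists>p. fc_involution_expr n = fps_of_poly p"
proof -
  have "{h \<in> cyc n. 0 \<notin> set h} = {}"
    unfolding positive_cyc_eq using O_walks_odd_empty[OF assms(1)] by simp
  then have "cyc n = {h \<in> cyc n. 0 \<in> set h}" by blast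
  then have "finite (cyc n)" using finite_zero_hitting_cyc[of n] by simp
  from gen_fun_polynomial[OF this] show ?thesis
    using gen_fun_cyc[OF assms(2)] by metis
qed

text \<open>Two antipodal heights of a cyclic walk meeting the axis add up to at most \<open>k\<close>.\<close>

lemma zero_hitting_bound:
  assumes "h \<in> cyc (2 * k)" "0 \<in> set h"
  shows "sum_list (tl h) \<le> k\<^sup>2"
proof -
  have len: "length h = 2 * k + 1" and s: "successively floor_step h" and c: "h ! 0 = h ! (2 * k)"
    using assms(1) hd_last_nth[of h "2 * k"] by (auto simp: cyc_def)
  from assms(2) obtain z where z: "z \<le> 2 * k" "h ! z = 0"
    using len by (auto simp: in_set_conv_nth less_Suc_eq_le)
  note b = successively_bound[OF s]
  have pair: "h ! i + h ! (i + k) \<le> k" if i: "i \<le> k" for i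
  proof -
    \<comment> \<open>Positions \<open>i\<close> and \<open>i + k\<close> cut the cycle into two
      arcs of length \<open>k\<close>. The zero lies on one of them, and its distances to the two
      ends add up to \<open>k\<close>; on the arc through position 0 the equality of first and last
      height is used.\<close>
    consider "z \<le> i" | "i \<le> z" "z \<le> i + k" | "i + k \<le> z" by linarith
    then show ?thesis
    proof cases
      case 1
      then show ?thesis
        using b[of z i] b[of "i + k" "2 * k"] b[of 0 z] z len c i by (auto; linarith)
    next
      case 2
      then show ?thesis
        using b[of i z] b[of z "i + k"] z len c i by (auto; linarith)
    next
      case 3
      then show ?thesis
        using b[of "i + k" z] b[of z "2 * k"] b[of 0 i] z len c i by (auto; linarith)
    qed
  qed
  have "sum_list (tl h) = (\<Sum>i=1..2 * k. h ! i)"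
    using sum_nth_eq_sum_list_tl[of h "2 * k"] len by simp
  also have "{1..2 * k} = {1..k} \<union> (\<lambda>i. i + k) ` {1..k}"
  proof (intro equalityI subsetI)
    fix i assume "i \<in> {1..2 * k}"
    then show "i \<in> {1..k} \<union> (\<lambda>i. i + k) ` {1..k}"
      by (cases "i \<le> k") (auto intro!: image_eqI[of _ _ "i - k"])
  qed auto
  also have "(\<Sum>i\<in>{1..k} \<union> (\<lambda>i. i + k) ` {1..k}. h ! i) = (\<Sum>i=1..k. h ! i) + (\<Sum>i=1..k. h ! (i + k))"
    by (subst sum.union_disjoint) (auto simp: sum.reindex simp del: image_add_atLeastAtMost')
  also have "\<dots> = (\<Sum>i=1..k. h ! i + h ! (i + k))" by (simp add: sum.distrib)
  also have "\<dots> \<le> (\<Sum>i=1..k. k)" by (intro sum_mono pair) auto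
  finally show ?thesis by (simp add: power2_eq_square)
qed

text \<open>Walks meeting the axis have area at most \<open>n^2 / 4\<close>, so from the next area
  on only positive walks are left, and raising them by one adds n.\<close>

lemma card_cyc_periodic:
  assumes "even n" "n > 0" "l \<ge> 1 + n\<^sup>2 div 4"
  shows "card {h \<in> cyc n. sum_list (tl h) = l + n} = card {h \<in> cyc n. sum_list (tl h) = l}"
proof -
  from assms(1) obtain k where k: "n = 2 * k" by (elim evenE)
  then have bound: "sum_list (tl h) \<le> n\<^sup>2 div 4" if "h \<in> cyc n" "0 \<in> set h" for h
    using zero_hitting_bound[of h k] that by (simp add: power_mult_distrib)
  have pos: "{h \<in> cyc n. sum_list (tl h) = l'} = {h \<in> O_walks n. 0 \<notin> set h \<and> sum_list (tl h) = l'}"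
    if "l' \<ge> l" for l'
    using bound positive_cyc_eq[of n] O_walks_subset_cyc[of n] that assms(3) by force
  \<comment> \<open>The raising map is defined on all of \<open>O_walks\<close>; at area
    \<open>l\<close> these are exactly the cyclic walks, as no walk of this area needs a horizontal
    step.\<close>
  have all: "{h \<in> cyc n. sum_list (tl h) = l} = {h \<in> O_walks n. sum_list (tl h) = l}"
    using pos[of l] O_walks_subset_cyc[of n] by auto
  have "bij_betw (map Suc) {h \<in> O_walks n. sum_list (tl h) = l}
      {h \<in> O_walks n. 0 \<notin> set h \<and> sum_list (tl h) = l + n}"
    using bij_betw_Collect[OF bij_betw_raise, of n "\<lambda>h. sum_list (tl h) = l + n" "\<lambda>h. sum_list (tl h) = l"]
    by (simp add: sum_list_tl_raise conj_assoc)
  then show ?thesis using pos[of "l + n"] all by (simp add: bij_betw_same_card)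
qed

section \<open>The bijection between involutions and cyclic walks\<close>

context affine_A
begin

lemma nth_cyc:
  assumes "length h = n + 1"
  shows "h \<in> cyc n \<longleftrightarrow> h ! n = h ! 0 \<and> valid_heights (\<lambda>i. h ! i)"
proof -
  have "valid_heights (\<lambda>i. h ! i) \<longleftrightarrow> (\<forall>i<n. floor_step (h ! i) (h ! Suc i))" if "h ! n = h ! 0"
  proof -
    \<comment> \<open>At \<open>i = n - 1\<close> the successor wraps around to 0, which the
      repeated last entry represents.\<close>
    have "h ! nxt i = h ! Suc i" if "i < n" for i
      using that \<open>h ! n = h ! 0\<close> by (cases "Suc i = n") (auto simp: nxt_if)
    then show ?thesis by (auto simp: valid_heights_def floor_step_def unit_step_def)
  qed
  then show ?thesis using assms hd_last_nth[OF assms]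
    by (auto simp: cyc_def successively_conv_nth)
qed

lemma valid_heights_cong: "(\<And>i. i < n \<Longrightarrow> h i = h' i) \<Longrightarrow> valid_heights h = valid_heights h'"
  by (simp add: valid_heights_def)

lemma heights_word_cong: "(\<And>i. i < n \<Longrightarrow> h i = h' i) \<Longrightarrow> heights_word h u = heights_word h' u"
  by (simp add: heights_word_def)

text \<open>The choice of the reduced word is immaterial for a fully commutative element, since
  commutations preserve the number of each letter.\<close>

definition heights :: "nat list set \<Rightarrow> nat list" where
  "heights w = map (count_list (SOME u. u \<in> reduced_words w)) ([0..<n] @ [0])"

lemma length_heights: "length (heights w) = n + 1"
  by (simp add: heights_def)

lemma fc_involution_heights:
  assumes "w \<in> affine_A_fc_involutions n"
  shows "heights w \<in> cyc n" "\<exists>u\<in>reduced_words w. heights_word (\<lambda>i. heights w ! i) u"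
proof -
  define u where "u = (SOME u. u \<in> reduced_words w)"
  have carr: "w \<in> carrier (coxeter_group {..<n} mat)"
    using assms by (simp add: affine_A_fc_involutions_def fc_involutions_def)
  then have u: "u \<in> reduced_words w"
    unfolding u_def by (rule someI_ex[OF reduced_words_nonempty])
  from fc_involution_heights_word[OF assms this]
  have vg: "valid_heights (count_list u)" "heights_word (count_list u) u" by auto
  have nth: "heights w ! i = count_list u i" if "i < n" for i
    using that by (simp add: heights_def u_def nth_append)
  have n: "heights w ! n = count_list u 0" by (simp add: heights_def u_def nth_append)
  show "heights w \<in> cyc n"
    unfolding nth_cyc[OF length_heights] using n nth[of 0] n_ge_3 vg(1)
    by (simp add: valid_heights_cong[OF nth])
  show "\<exists>u\<in>reduced_words w. heights_word (\<lambda>i. heights w ! i) u"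
    using u vg(2) by (auto simp: heights_word_cong[OF nth])
qed

lemma sum_nth_tl_cyc:
  assumes "h \<in> cyc n"
  shows "(\<Sum>i<n. h ! i) = sum_list (tl h)"
proof -
  have l: "length h = n + 1" using assms by (simp add: cyc_def)
  have "h ! n = h ! 0" using assms nth_cyc[OF l] by simp
  have "(\<Sum>i<n. h ! i) + h ! n = (\<Sum>i=0..n. h ! i)"
    by (simp add: lessThan_Suc_atMost[symmetric] atLeast0AtMost)
  also have "\<dots> = h ! 0 + (\<Sum>i=1..n. h ! i)"
    by (simp add: sum.atLeast_Suc_atMost)
  finally show ?thesis
    using \<open>h ! n = h ! 0\<close> sum_nth_eq_sum_list_tl[OF l] by simp
qed

text \<open>Injectivity holds because heights prescribe all edge projections and thus a word up to
  commutation; surjectivity because every valid height function has a word, whose class is a fully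
  commutative involution.\<close>

lemma bij_betw_heights: "bij_betw heights (affine_A_fc_involutions n) (cyc n)"
proof (rule bij_betw_imageI)
  show "inj_on heights (affine_A_fc_involutions n)"
  proof (rule inj_onI)
    fix w w' assume w: "w \<in> affine_A_fc_involutions n" "w' \<in> affine_A_fc_involutions n"
      and eq: "heights w = heights w'"
    obtain u u' where u: "u \<in> reduced_words w" "u' \<in> reduced_words w'"
      "heights_word (\<lambda>i. heights w ! i) u" "heights_word (\<lambda>i. heights w ! i) u'"
      using fc_involution_heights(2)[OF w(1)] fc_involution_heights(2)[OF w(2)] eq by metis
    then have "cong u u'"
      using heights_word_unique[OF u(3,4)] by (intro comm_imp_cong) (auto simp: heights_word_def)
    moreover have "w = coxeter_class {..<n} mat u" "w' = coxeter_class {..<n} mat u'"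
      using w u by (auto intro!: carrier_eq_coxeter_class
        simp: affine_A_fc_involutions_def fc_involutions_def reduced_words_def)
    ultimately show "w = w'" by (simp only: coxeter_class_eq)
  qed
  show "heights ` affine_A_fc_involutions n = cyc n"
  proof (intro equalityI subsetI)
    fix h assume h: "h \<in> cyc n"
    then have l: "length h = n + 1" by (simp add: cyc_def)
    with h have v: "valid_heights (\<lambda>i. h ! i)" "h ! n = h ! 0" by (auto simp: nth_cyc)
    then obtain u where u: "heights_word (\<lambda>i. h ! i) u" using heights_word_exists by blast
    define w where "w = coxeter_class {..<n} mat u"
    note w = heights_word_class[OF v(1) u, folded w_def]
    \<comment> \<open>The chosen word may differ from \<open>u\<close>, but every reduced word of
      \<open>w\<close> has the projections prescribed by \<open>h\<close>, hence the same
      counts.\<close>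
    have "(SOME u. u \<in> reduced_words w) \<in> reduced_words w"
      by (rule someI[of _ u]) (simp add: w u)
    then have g: "heights_word (\<lambda>i. h ! i) (SOME u. u \<in> reduced_words w)" by (simp add: w)
    have "heights w = h"
    proof (rule nth_equalityI)
      fix i assume "i < length (heights w)"
      then have "i < n \<or> i = n" unfolding length_heights by linarith
      then show "heights w ! i = h ! i"
        using heights_word_count[OF v(1) g] v(2) n_ge_3 by (auto simp: heights_def nth_append)
    qed (simp add: l length_heights)
    with w(1) show "h \<in> heights ` affine_A_fc_involutions n" by blast
  qed (auto intro: fc_involution_heights)
qed

lemma sum_heights:
  assumes "w \<in> affine_A_fc_involutions n"
  shows "sum_list (tl (heights w)) = coxeter_length w"
proof -
  from fc_involution_heights[OF assms] obtain u
    where h: "heights w \<in> cyc n" and u: "u \<in> reduced_words w" "heights_word (\<lambda>i. heights w ! i) u" by blast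
  have "valid_heights (\<lambda>i. heights w ! i)" using h nth_cyc[OF length_heights] by simp
  then have "length u = sum_list (tl (heights w))"
    using heights_word_length[OF _ u(2)] sum_nth_tl_cyc[OF h] by simp
  then show ?thesis using u(1) by (simp add: reduced_words_def)
qed

lemma fc_involution_count_eq: "fc_involution_count n l = card {h \<in> cyc n. sum_list (tl h) = l}"
proof -
  have "bij_betw heights {w \<in> affine_A_fc_involutions n. coxeter_length w = l}
      {h \<in> cyc n. sum_list (tl h) = l}"
    by (rule bij_betw_Collect[OF bij_betw_heights]) (simp add: sum_heights)
  then show ?thesis by (simp add: fc_involution_count_def bij_betw_same_card)
qed

end

theorem proposition3p3:
  fixes n :: nat
  assumes "n \<ge> 3"
  shows "gen_fun (affine_A_fc_involutions n) coxeter_length = fc_involution_expr n \<and>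
    (odd n \<longrightarrow> (\<exists>p :: rat poly. fc_involution_expr n = fps_of_poly p)) \<and>
    (even n \<longrightarrow> (\<exists>p>0. p dvd n \<and>
       (\<forall>l \<ge> 1 + n\<^sup>2 div 4. fc_involution_count n (l + p) = fc_involution_count n l)))"
proof (intro conjI impI)
  interpret affine_A n using assms by unfold_locales
  have "gen_fun (affine_A_fc_involutions n) coxeter_length = gen_fun (cyc n) (\<lambda>h. sum_list (tl h))"
    by (rule gen_fun_bij_betw[OF bij_betw_heights]) (rule sum_heights)
  also have "\<dots> = fc_involution_expr n" using assms by (intro gen_fun_cyc) simp
  finally show "gen_fun (affine_A_fc_involutions n) coxeter_length = fc_involution_expr n" .
  show "\<exists>p :: rat poly. fc_involution_expr n = fps_of_poly p" if "odd n"
    using fc_involution_expr_polynomial[OF that] assms by simp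
  show "\<exists>p>0. p dvd n \<and>
      (\<forall>l \<ge> 1 + n\<^sup>2 div 4. fc_involution_count n (l + p) = fc_involution_count n l)" if "even n"
    using card_cyc_periodic[OF that] assms
    \<comment> \<open>The witness for the period is n itself.\<close>
    by (intro exI[of _ n]) (simp add: fc_involution_count_eq)
qed

end
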